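(* Let $\widehat{\mathfrak g}$ be an affine Kac-Moody Lie algebra of type $(ADE)^{(1)}$ with Cartan matrix $(a_{ij})_{i,j=0}^n$, let $L$ be a restricted $U_q(\widehat{\mathfrak g})$-module, let $\mathsf q=q^{-2}$ and $$\mathcal T=\{x_i^-(z)\otimes1\,:\,i=1,\dots,n\}\subset\mathcal E(L)_t .$$ There exists a unique smallest graded nonlocal $\mathsf q$-vertex algebra $(\langle\mathcal T\rangle,Y,\mathbf 1)$ (inside $\mathcal E(L)_t$) which contains $\mathcal T$. Furthermore, $\langle\mathcal T\rangle$ is spanned by $$\left\{(x_{i_1}^{-}(z)\otimes 1)_{r_1}\cdots (x_{i_m}^{-}(z)\otimes 1)_{r_m}\mathbf 1\,:\,1\leq i_j\leq n,\ r_j<0,\ j=1,\dots,m,\ m\in\mathbb{Z}_{\geq 0}\right\}.$$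
   Context: Quantum affine algebra (Drinfeld realization, simply laced case). $q$ is an indeterminate, $[m]=(q^m-q^{-m})/(q-q^{-1})$, with corresponding factorials and (symmetric) binomials $\binom{m}{s}_q=[m][m-1]\cdots[m-s+1]/[s]!$. $U_q(\widehat{\mathfrak g})$ is the unital associative algebra over $\mathbb C(q^{1/2})$ generated by $x_i^\pm(k)$, $a_i(l)$, $K_i^{\pm1}$, $\gamma^{\pm1/2}$, $q^{\pm d}$ ($1\le i\le n$, $k,l\in\mathbb Z$, $l\ne0$) with relations: $\gamma^{\pm1/2}$ central; $K_iK_j=K_jK_i$, $K_iK_i^{-1}=K_i^{-1}K_i=1$; $[a_i(k),a_j(l)]=\delta_{k+l,0}\frac{[a_{ij}k]}{k}\frac{\gamma^k-\gamma^{-k}}{q-q^{-1}}$; $[a_i(k),K_j^{\pm1}]=[q^{\pm d},K_j^{\pm1}]=0$; $q^dx_i^\pm(k)q^{-d}=q^kx_i^\pm(k)$, $q^da_i(l)q^{-d}=q^la_i(l)$; $K_ix_j^\pm(k)K_i^{-1}=q^{\pm a_{ij}}x_j^\pm(k)$; $[a_i(k),x_j^\pm(l)]=\pm\frac{[a_{ij}k]}{k}\gamma^{\mp|k|/2}x_j^\pm(k+l)$; $x_i^\pm(k+1)x_j^\pm(l)-q^{\pm a_{ij}}x_j^\pm(l)x_i^\pm(k+1)=q^{\pm a_{ij}}x_i^\pm(k)x_j^\pm(l+1)-x_j^\pm(l+1)x_i^\pm(k)$; $[x_i^+(k),x_j^-(l)]=\frac{\delta_{ij}}{q-q^{-1}}(\gamma^{(k-l)/2}\psi_i(k+l)-\gamma^{(l-k)/2}\phi_i(k+l))$;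 and for $i\ne j$, $m=1-a_{ij}$, $\operatorname{Sym}_{l_1,\dots,l_m}\sum_{s=0}^m(-1)^s\binom ms_qx_i^\pm(l_1)\cdots x_i^\pm(l_s)x_j^\pm(k)x_i^\pm(l_{s+1})\cdots x_i^\pm(l_m)=0$. Here $\sum_{r\ge0}\phi_i(-r)z^r=K_i^{-1}\exp(-(q-q^{-1})\sum_{r\ge1}a_i(-r)z^r)$, $\sum_{r\ge0}\psi_i(r)z^{-r}=K_i\exp((q-q^{-1})\sum_{r\ge1}a_i(r)z^{-r})$, other $\phi_i(k),\psi_i(k)$ being $0$. On a module, $x_i^\pm(z)=\sum_{r\in\mathbb Z}x_i^\pm(r)z^{-r-1}$. $L$ restricted means that for every $v\in L$ and $i$, $x_i^\pm(r)v=0$ for $r$ sufficiently large, i.e. $x_i^\pm(z)\in\mathcal E(L)$. Operators. Let $\mathbb F=\mathbb C(q^{1/2})$. $L((z_1,\dots,z_m))$ denotes Laurent series with exponents bounded below in each variable; $\mathcal E(L)=\operatorname{Hom}(L,L((z)))$, $\mathcal E(L)_t=\mathcal E(L)\otimes\mathbb F[t]$; $a(z)\otimes t^\alpha$ is homogeneous of weight $\alpha$. $[r]_{\mathsf q}=(\mathsf q^r-1)/(\mathsf q-1)$, $[r]_{\mathsf q}!$ and $\binom ml_{\mathsf q}=[m]_{\mathsf q}\cdots[m-l+1]_{\mathsf q}/[l]_{\mathsf q}!$ as usual. $a^{[1]}(z)=\frac{a(z\mathsf q)-a(z)}{z(\mathsf q-1)}$, $a^{[r]}$ its $r$-th iterate.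 $\mathbb F[z]_0=\{p\in\mathbb F[z]:p(1)=1,\ p(\mathsf q^n)\ne0\ \forall n\in\mathbb Z_{\ge0}\}$. A sequence $(a_1(z)\otimes t^{\alpha_1},\dots,a_m(z)\otimes t^{\alpha_m})$ is quasi-commutative if for some $p\in\mathbb F[z]_0$, $\bigl(\prod_{i<j}p(z_j/z_i)\bigr)a_1(z_1)a_2(z_2\mathsf q^{\alpha_1})\cdots a_m(z_m\mathsf q^{\alpha_1+\cdots+\alpha_{m-1}})\in\operatorname{Hom}(L,L((z_1,\dots,z_m)))$; a sequence of general elements is quasi-commutative if all choices of homogeneous components are. For a quasi-commutative pair and $r\ge0$, $(a(z)\otimes t^\alpha)_{-r-1}(b(z)\otimes t^\beta)=\lim_{z_1\to z}\frac{p(z/z_1)}{[r]_{\mathsf q}!}a^{[r]}(z_1)b(z\mathsf q^{\alpha+r})\otimes t^{\alpha+\beta+r}$, with any $p\in\mathbb F[z]_0$ such that $p(z/z_1)a^{[r]}(z_1)b(z\mathsf q^{\alpha+r})\in\operatorname{Hom}(L,L((z_1,z)))$ (set $z_1=z$; independent of $p$); for $r<0$ the product is $0$; extend bilinearly. $Y(a,z_0)b=\sum_r(a_rb)z_0^{-r-1}$, $\mathbf 1=1\otimes1$. Iterated products are nested to the right. A graded nonlocal $\mathsf q$-vertex algebra is a $\mathbb Z$-graded space $V=\coprod_uV_{(u)}$ with a linear map $Y(\cdot,z_0):V\to(\operatorname{End}V)[[z_0^{\pm1}]]$, $Y(a,z_0)=\sum_ra_rz_0^{-r-1}$, and $\mathbf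 1\in V$ such that: $a_rb=0$ for $r\gg0$; $Y(\mathbf 1,z_0)=1_V$; $Y(a,z_0)\mathbf 1\in V[[z_0]]$ has constant term $a$; $a_rV_{(s)}\subseteq V_{(s+u-r-1)}$ for $a\in V_{(u)}$; and for $a\in V_{(u)}$, $b,c\in V$, $r,s\in\mathbb Z$: $(a_rb)_sc=\sum_{l\ge0}\binom{l-r-1}{l}_{\mathsf q}\mathsf q^{(s+l+1)(r-u+1)}a_{r-l}(b_{s+l}c)$ (this is $Y(a,z_0+z_2)Y(b,z_2\mathsf q^u)c=Y(Y(a,z_0)b,z_2)c$ with $z_2z_0=\mathsf qz_0z_2$). A graded nonlocal $\mathsf q$-vertex algebra inside $\mathcal E(L)_t$ is a subspace $V$ whose pairs are quasi-commutative, containing $\mathbf 1$, closed under all products, satisfying these axioms with $Y(a,z_0)b=\sum_{r\in\mathbb Z}(a_rb)z_0^{-r-1}$ formed from the products $a_rb$ of quasi-commutative pairs in $\mathcal E(L)_t$, with $\mathbf 1=1\otimes1$ (identity operator of $L$ tensor $1$), and with $V_{(u)}=\{a(z)\otimes t^u\in V\}$. *)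

theory Defs
  imports
    "HOL-Library.Function_Algebras"
    "HOL-Computational_Algebra.Polynomial"
    "HOL-Computational_Algebra.Fraction_Field"
    "HOL-Combinatorics.Permutations"
    Complex_Main
begin

section \<open>\<open>Q\<close>-numbers\<close>

definition qnum :: "'k::field \<Rightarrow> int \<Rightarrow> 'k" where
  "qnum Q m = (Q powi m - 1) / (Q - 1)"

definition qfact :: "'k::field \<Rightarrow> nat \<Rightarrow> 'k" where
  "qfact Q r = (\<Prod>i=1..r. qnum Q (int i))"

definition qbinom :: "'k::field \<Rightarrow> int \<Rightarrow> nat \<Rightarrow> 'k" where
  "qbinom Q m l = (\<Prod>i<l. qnum Q (m - int i)) / qfact Q l"


section \<open>Graded nonlocal \<open>Q\<close>-vertex algebras\<close>

text \<open>
  The underlying space is a subspace \<open>V\<close> of an ambient vector space, \<open>G u\<close> is the homogeneous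
  subspace of weight \<open>u\<close>, and \<open>md r a b\<close> is the mode product \<open>a\<^sub>r b\<close>, so that \<open>Y(a, z) b\<close> is the sum of
  the \<open>md r a b z^(-r-1)\<close>.  In \<open>associativity\<close> the infinite sum over \<open>l\<close> is taken over those \<open>l\<close>
  with \<open>b\<^sub>(\<^sub>s\<^sub>+\<^sub>l\<^sub>)c\<close> nonzero, a finite set by \<open>truncation\<close>.
\<close>

locale graded_nonlocal_qva = vector_space sc
  for sc :: "'k::field \<Rightarrow> 'v::ab_group_add \<Rightarrow> 'v" +
  fixes Q :: 'k
    and V :: "'v set"
    and G :: "int \<Rightarrow> 'v set"
    and md :: "int \<Rightarrow> 'v \<Rightarrow> 'v \<Rightarrow> 'v"
    and vac :: 'v
  assumes subspace_V: "subspace V"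
    and subspace_G: "subspace (G u)" "G u \<subseteq> V"
    and direct_sum: "a \<in> V \<Longrightarrow>
      \<exists>!f. (\<forall>u. f u \<in> G u) \<and> finite {u. f u \<noteq> 0} \<and> a = (\<Sum>u | f u \<noteq> 0. f u)"
    and md_closed: "a \<in> V \<Longrightarrow> b \<in> V \<Longrightarrow> md r a b \<in> V"
    and md_add_left: "a \<in> V \<Longrightarrow> a' \<in> V \<Longrightarrow> b \<in> V \<Longrightarrow> md r (a + a') b = md r a b + md r a' b"
    and md_add_right: "a \<in> V \<Longrightarrow> b \<in> V \<Longrightarrow> b' \<in> V \<Longrightarrow> md r a (b + b') = md r a b + md r a b'"
    and md_scale_left: "a \<in> V \<Longrightarrow> b \<in> V \<Longrightarrow> md r (sc x a) b = sc x (md r a b)"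
    and md_scale_right: "a \<in> V \<Longrightarrow> b \<in> V \<Longrightarrow> md r a (sc x b) = sc x (md r a b)"
    and truncation: "a \<in> V \<Longrightarrow> b \<in> V \<Longrightarrow> \<exists>N. \<forall>r\<ge>N. md r a b = 0"
    and vac_in: "vac \<in> V"
    and vacuum: "b \<in> V \<Longrightarrow> md r vac b = (if r = -1 then b else 0)"
    and creation: "a \<in> V \<Longrightarrow> md (-1) a vac = a" "a \<in> V \<Longrightarrow> r \<ge> 0 \<Longrightarrow> md r a vac = 0"
    and grading: "a \<in> G u \<Longrightarrow> b \<in> G s \<Longrightarrow> md r a b \<in> G (s + u - r - 1)"
    and associativity: "a \<in> G u \<Longrightarrow> b \<in> V \<Longrightarrow> c \<in> V \<Longrightarrow>
      md s (md r a b) c =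
        (\<Sum>l | md (s + int l) b c \<noteq> 0.
          sc (qbinom Q (int l - r - 1) l * Q powi ((s + int l + 1) * (r - u + 1)))
             (md (r - int l) a (md (s + int l) b c)))"


section \<open>Operator-valued Laurent series and their products\<close>

text \<open>
  An operator-valued series \<open>a(z)\<close> is represented by its coefficients: \<open>a n\<close> is the
  coefficient of \<open>z^n\<close> (not of \<open>z^(-n-1)\<close>).  Likewise \<open>F m n\<close> is the coefficient of
  \<open>z\<^sub>1^m z\<^sub>2^n\<close> of a series in two variables.
\<close>

type_synonym 'l ser = "int \<Rightarrow> 'l \<Rightarrow> 'l"
type_synonym 'l ser2 = "int \<Rightarrow> int \<Rightarrow> 'l \<Rightarrow> 'l"

locale operator_series = vector_space s
  for s :: "'k::field \<Rightarrow> 'l::ab_group_add \<Rightarrow> 'l" +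
  fixes Q :: 'k
begin

text \<open>\<open>Hom(L, L((z)))\<close> and \<open>Hom(L, L((z\<^sub>1, z\<^sub>2)))\<close>:\<close>

definition E :: "'l ser set" where
  "E = {a. (\<forall>n. Vector_Spaces.linear s s (a n)) \<and> (\<forall>v. \<exists>N. \<forall>n<N. a n v = 0)}"

definition E2 :: "'l ser2 set" where
  "E2 = {F. (\<forall>m n. Vector_Spaces.linear s s (F m n)) \<and>
            (\<forall>v. \<exists>M N. \<forall>m n. F m n v \<noteq> 0 \<longrightarrow> M \<le> m \<and> N \<le> n)}"

text \<open>
  \<open>\<E>(L) \<otimes> F[t]\<close> is rendered as polynomials in \<open>t\<close> with coefficients in \<open>E\<close>; thus
  \<open>a(z) \<otimes> t^\<alpha>\<close> is \<open>monom a \<alpha>\<close>.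
\<close>

definition Et :: "'l ser poly set" where
  "Et = {A. \<forall>\<alpha>. coeff A \<alpha> \<in> E}"

definition et_scale :: "'k \<Rightarrow> 'l ser poly \<Rightarrow> 'l ser poly" where
  "et_scale c = map_poly (\<lambda>a n v. s c (a n v))"

lemma coeff_et_scale: "coeff (et_scale c A) \<alpha> = (\<lambda>n v. s c (coeff A \<alpha> n v))"
  unfolding et_scale_def by (subst coeff_map_poly) (auto simp: zero_fun_def)

sublocale et: vector_space et_scale
  by unfold_locales
    (auto intro!: poly_eqI simp: coeff_et_scale fun_eq_iff scale_right_distrib scale_left_distrib)

text \<open>The series \<open>a(cz)\<close> and the \<open>Q\<close>-derivative \<open>a\<^sup>[\<^sup>1\<^sup>](z) = (a(Qz) - a(z)) / (z(Q - 1))\<close>:\<close>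

definition dilate :: "'k \<Rightarrow> 'l ser \<Rightarrow> 'l ser" where
  "dilate c a = (\<lambda>n v. s (c powi n) (a n v))"

definition qderiv :: "'l ser \<Rightarrow> 'l ser" where
  "qderiv a = (\<lambda>n v. s (1 / (Q - 1)) (dilate Q a (n + 1) v - a (n + 1) v))"

text \<open>\<open>a(z\<^sub>1) b(z\<^sub>2)\<close>, multiplication of a series in two variables by \<open>p(z\<^sub>2 / z\<^sub>1)\<close>, and the
  specialization \<open>z\<^sub>1 = z\<^sub>2 = z\<close> (a finite sum for series in \<open>E2\<close>):\<close>

definition prod2 :: "'l ser \<Rightarrow> 'l ser \<Rightarrow> 'l ser2" where
  "prod2 a b = (\<lambda>m n v. a m (b n v))"

definition mult_ratio :: "'k poly \<Rightarrow> 'l ser2 \<Rightarrow> 'l ser2" where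
  "mult_ratio p F = (\<lambda>m n v. \<Sum>k\<le>degree p. s (coeff p k) (F (m + int k) (n - int k) v))"

definition diag :: "'l ser2 \<Rightarrow> 'l ser" where
  "diag F = (\<lambda>n v. \<Sum>m | F m (n - m) v \<noteq> 0. F m (n - m) v)"

definition poly0 :: "'k poly set" where
  "poly0 = {p. poly p 1 = 1 \<and> (\<forall>n::nat. poly p (Q ^ n) \<noteq> 0)}"

text \<open>Quasi-commutativity of pairs, first for \<open>(a(z) \<otimes> t^\<alpha>, b(z) \<otimes> t^\<beta>)\<close> (where \<open>\<beta>\<close> plays no
  role), then for all choices of homogeneous components.\<close>

definition quasi_comm_hom :: "'l ser \<Rightarrow> nat \<Rightarrow> 'l ser \<Rightarrow> bool" where
  "quasi_comm_hom a \<alpha> b \<longleftrightarrow> (\<exists>p\<in>poly0. mult_ratio p (prod2 a (dilate (Q ^ \<alpha>) b)) \<in> E2)"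

definition quasi_comm :: "'l ser poly \<Rightarrow> 'l ser poly \<Rightarrow> bool" where
  "quasi_comm A B \<longleftrightarrow> (\<forall>\<alpha> \<beta>. quasi_comm_hom (coeff A \<alpha>) \<alpha> (coeff B \<beta>))"

text \<open>
  The series part of \<open>(a(z) \<otimes> t^\<alpha>)\<^sub>-\<^sub>r\<^sub>-\<^sub>1 (b(z) \<otimes> t^\<beta>)\<close>.  For a quasi-commutative pair an
  admissible \<open>p\<close> exists and the result does not depend on its choice.
\<close>

definition prod_hom :: "nat \<Rightarrow> 'l ser \<Rightarrow> nat \<Rightarrow> 'l ser \<Rightarrow> 'l ser" where
  "prod_hom r a \<alpha> b =
     (let F = prod2 ((qderiv ^^ r) a) (dilate (Q ^ (\<alpha> + r)) b);
          p = (SOME p. p \<in> poly0 \<and> mult_ratio p F \<in> E2)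
      in (\<lambda>n v. s (1 / qfact Q r) (diag (mult_ratio p F) n v)))"

definition nprod :: "int \<Rightarrow> 'l ser poly \<Rightarrow> 'l ser poly \<Rightarrow> 'l ser poly" where
  "nprod k A B =
     (if k < 0 then
        (let r = nat (- k - 1) in
         \<Sum>\<alpha>\<le>degree A. \<Sum>\<beta>\<le>degree B.
           monom (prod_hom r (coeff A \<alpha>) \<alpha> (coeff B \<beta>)) (\<alpha> + \<beta> + r))
      else 0)"

definition vac :: "'l ser poly" where
  "vac = monom (\<lambda>n v. if n = 0 then v else 0) 0"

text \<open>\<open>{a(z) \<otimes> t^u \<in> V}\<close>; this is \<open>{0}\<close> for negative \<open>u\<close>.\<close>

definition weight_space :: "'l ser poly set \<Rightarrow> int \<Rightarrow> 'l ser poly set" where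
  "weight_space V u = {A \<in> V. \<forall>\<alpha>. coeff A \<alpha> \<noteq> 0 \<longrightarrow> int \<alpha> = u}"

definition qva_in_Et :: "'l ser poly set \<Rightarrow> bool" where
  "qva_in_Et V \<longleftrightarrow> V \<subseteq> Et \<and> (\<forall>A\<in>V. \<forall>B\<in>V. quasi_comm A B) \<and>
     graded_nonlocal_qva et_scale Q V (weight_space V) nprod vac"

definition smallest_qva :: "'l ser poly set \<Rightarrow> 'l ser poly set \<Rightarrow> bool" where
  "smallest_qva T V \<longleftrightarrow> qva_in_Et V \<and> T \<subseteq> V \<and> (\<forall>W. qva_in_Et W \<and> T \<subseteq> W \<longrightarrow> V \<subseteq> W)"

definition generated_qva :: "'l ser poly set \<Rightarrow> 'l ser poly set" where
  "generated_qva T = (THE V. smallest_qva T V)"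

end


section \<open>Affine Cartan matrices of type \<open>(ADE)^(1)\<close>\<close>

datatype ade = TypeA nat | TypeD nat | TypeE nat

fun ade_rank :: "ade \<Rightarrow> nat" where
  "ade_rank (TypeA l) = l"
| "ade_rank (TypeD l) = l"
| "ade_rank (TypeE l) = l"

fun ade_valid :: "ade \<Rightarrow> bool" where
  "ade_valid (TypeA l) \<longleftrightarrow> l \<ge> 1"
| "ade_valid (TypeD l) \<longleftrightarrow> l \<ge> 4"
| "ade_valid (TypeE l) \<longleftrightarrow> l \<in> {6, 7, 8}"

text \<open>Edges of the affine Dynkin diagram in Bourbaki numbering, 0 being the affine node.  For
  \<open>TypeA 1\<close> the list is \<open>[(0, 1), (1, 0)]\<close>, a double edge, giving the off-diagonal entry -2.\<close>

fun affine_edges :: "ade \<Rightarrow> (nat \<times> nat) list" where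
  "affine_edges (TypeA l) = map (\<lambda>i. (i, i + 1)) [0..<l] @ [(l, 0)]"
| "affine_edges (TypeD l) = (0, 2) # map (\<lambda>i. (i, i + 1)) [1..<l - 1] @ [(l - 2, l)]"
| "affine_edges (TypeE l) =
     (0, if l = 6 then 2 else if l = 7 then 1 else 8) #
     [(1, 3), (2, 4)] @ map (\<lambda>i. (i, i + 1)) [3..<l]"

definition affine_cartan :: "ade \<Rightarrow> nat \<Rightarrow> nat \<Rightarrow> int" where
  "affine_cartan X i j =
     (if i = j then 2
      else - int (length (filter (\<lambda>e. e = (i, j) \<or> e = (j, i)) (affine_edges X))))"

text \<open>The numbering of the nodes \<open>1, \<dots>, n\<close> is left arbitrary.\<close>

definition affine_ADE :: "nat \<Rightarrow> (nat \<Rightarrow> nat \<Rightarrow> int) \<Rightarrow> bool" where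
  "affine_ADE n C \<longleftrightarrow>
     (\<exists>X \<pi>. ade_valid X \<and> ade_rank X = n \<and> bij_betw \<pi> {0..n} {0..n} \<and> \<pi> 0 = 0 \<and>
        (\<forall>i\<le>n. \<forall>j\<le>n. C i j = affine_cartan X (\<pi> i) (\<pi> j)))"


section \<open>Restricted modules of the quantum affine algebra\<close>

text \<open>The ground field \<open>\<complex>(q\<^sup>1\<^sup>/\<^sup>2)\<close>, with symmetric \<open>q\<close>-numbers and \<open>q\<close>-binomials.\<close>

type_synonym qfield = "complex poly fract"

definition q_half :: qfield where "q_half = Fract [:0, 1:] 1"

definition qq :: qfield where "qq = q_half ^ 2"

definition sqnum :: "int \<Rightarrow> qfield" where
  "sqnum m = (qq powi m - qq powi (- m)) / (qq - qq powi (- 1))"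

definition sqbinom :: "nat \<Rightarrow> nat \<Rightarrow> qfield" where
  "sqbinom m r = (\<Prod>i<r. sqnum (int m - int i)) / (\<Prod>i=1..r. sqnum (int i))"

text \<open>
  Drinfeld generators: \<open>X \<epsilon> i k\<close> is \<open>x\<^sub>i\<^sup>\<plusminus>(k)\<close> with \<open>\<epsilon> = \<plusminus>1\<close>, \<open>H i l\<close> is \<open>a\<^sub>i(l)\<close>, and \<open>K \<epsilon> i\<close>,
  \<open>Gamma_half \<epsilon>\<close>, \<open>QD \<epsilon>\<close> are the \<open>\<epsilon>\<close>-th powers of \<open>K\<^sub>i\<close>, \<open>\<gamma>\<^sup>1\<^sup>/\<^sup>2\<close>, \<open>q\<^sup>d\<close>.
\<close>

datatype drinfeld_gen =
  X int nat int | H nat int | K int nat | Gamma_half int | QD int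

definition generators :: "nat \<Rightarrow> drinfeld_gen set" where
  "generators n =
     {X \<epsilon> i k | \<epsilon> i k. \<epsilon> \<in> {1, -1} \<and> i \<in> {1..n}} \<union> {H i l | i l. i \<in> {1..n} \<and> l \<noteq> 0} \<union>
     {K \<epsilon> i | \<epsilon> i. \<epsilon> \<in> {1, -1} \<and> i \<in> {1..n}} \<union> {Gamma_half \<epsilon> | \<epsilon>. \<epsilon> \<in> {1, -1}} \<union>
     {QD \<epsilon> | \<epsilon>. \<epsilon> \<in> {1, -1}}"

text \<open>The action of \<open>\<gamma>\<^sup>k\<^sup>/\<^sup>2\<close>:\<close>

definition gam :: "(drinfeld_gen \<Rightarrow> 'l \<Rightarrow> 'l) \<Rightarrow> int \<Rightarrow> 'l \<Rightarrow> 'l" where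
  "gam \<rho> k = (if k \<ge> 0 then \<rho> (Gamma_half 1) ^^ nat k else \<rho> (Gamma_half (-1)) ^^ nat (- k))"

text \<open>Action of the coefficient of \<open>w^N\<close> in \<open>exp(c (h 1 w + h 2 w^2 + \<dots>))\<close>, where the exponential
  series is expanded as a sum over compositions of \<open>N\<close>.\<close>

definition exp_coeff ::
  "(qfield \<Rightarrow> 'l::ab_group_add \<Rightarrow> 'l) \<Rightarrow> qfield \<Rightarrow> (nat \<Rightarrow> 'l \<Rightarrow> 'l) \<Rightarrow> nat \<Rightarrow> 'l \<Rightarrow> 'l" where
  "exp_coeff s c h N v =
     (\<Sum>rs | 0 \<notin> set rs \<and> sum_list rs = N.
        s (c ^ length rs / of_nat (fact (length rs))) (foldr h rs v))"

definition psi ::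
  "(qfield \<Rightarrow> 'l::ab_group_add \<Rightarrow> 'l) \<Rightarrow> (drinfeld_gen \<Rightarrow> 'l \<Rightarrow> 'l) \<Rightarrow> nat \<Rightarrow> int \<Rightarrow> 'l \<Rightarrow> 'l" where
  "psi s \<rho> i k v =
     (if k \<ge> 0
      then \<rho> (K 1 i) (exp_coeff s (qq - qq powi (- 1)) (\<lambda>r. \<rho> (H i (int r))) (nat k) v)
      else 0)"

definition phi ::
  "(qfield \<Rightarrow> 'l::ab_group_add \<Rightarrow> 'l) \<Rightarrow> (drinfeld_gen \<Rightarrow> 'l \<Rightarrow> 'l) \<Rightarrow> nat \<Rightarrow> int \<Rightarrow> 'l \<Rightarrow> 'l" where
  "phi s \<rho> i k v =
     (if k \<le> 0
      then \<rho> (K (-1) i) (exp_coeff s (- (qq - qq powi (- 1))) (\<lambda>r. \<rho> (H i (- int r))) (nat (- k)) v)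
      else 0)"

text \<open>
  A module of the algebra presented by the Drinfeld generators and relations: a vector space \<open>L\<close>
  (scalar multiplication \<open>s\<close>) on which each generator \<open>g\<close> acts by a linear operator \<open>\<rho> g\<close> such that
  the defining relations hold.  \<open>C\<close> is the Cartan matrix.
\<close>

locale Uq_affine_module = vector_space s
  for s :: "qfield \<Rightarrow> 'l::ab_group_add \<Rightarrow> 'l" +
  fixes n :: nat
    and C :: "nat \<Rightarrow> nat \<Rightarrow> int"
    and \<rho> :: "drinfeld_gen \<Rightarrow> 'l \<Rightarrow> 'l"
  assumes linear_gen: "g \<in> generators n \<Longrightarrow> Vector_Spaces.linear s s (\<rho> g)"
    and gamma_inverse: "\<epsilon> \<in> {1, -1} \<Longrightarrow> \<rho> (Gamma_half \<epsilon>) (\<rho> (Gamma_half (- \<epsilon>)) v) = v"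
    and qd_inverse: "\<epsilon> \<in> {1, -1} \<Longrightarrow> \<rho> (QD \<epsilon>) (\<rho> (QD (- \<epsilon>)) v) = v"
    and K_inverse: "\<epsilon> \<in> {1, -1} \<Longrightarrow> i \<in> {1..n} \<Longrightarrow> \<rho> (K \<epsilon> i) (\<rho> (K (- \<epsilon>) i) v) = v"
    and gamma_central: "\<epsilon> \<in> {1, -1} \<Longrightarrow> g \<in> generators n \<Longrightarrow>
      \<rho> (Gamma_half \<epsilon>) (\<rho> g v) = \<rho> g (\<rho> (Gamma_half \<epsilon>) v)"
    and K_K: "i \<in> {1..n} \<Longrightarrow> j \<in> {1..n} \<Longrightarrow> \<rho> (K 1 i) (\<rho> (K 1 j) v) = \<rho> (K 1 j) (\<rho> (K 1 i) v)"
    and H_H: "i \<in> {1..n} \<Longrightarrow> j \<in> {1..n} \<Longrightarrow> k \<noteq> 0 \<Longrightarrow> l \<noteq> 0 \<Longrightarrow>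
      \<rho> (H i k) (\<rho> (H j l) v) - \<rho> (H j l) (\<rho> (H i k) v) =
        (if k + l = 0
         then s (sqnum (C i j * k) / of_int k * (1 / (qq - qq powi (- 1))))
                (gam \<rho> (2 * k) v - gam \<rho> (- 2 * k) v)
         else 0)"
    and H_K: "i \<in> {1..n} \<Longrightarrow> j \<in> {1..n} \<Longrightarrow> k \<noteq> 0 \<Longrightarrow> \<epsilon> \<in> {1, -1} \<Longrightarrow>
      \<rho> (H i k) (\<rho> (K \<epsilon> j) v) = \<rho> (K \<epsilon> j) (\<rho> (H i k) v)"
    and QD_K: "j \<in> {1..n} \<Longrightarrow> \<epsilon> \<in> {1, -1} \<Longrightarrow> \<epsilon>' \<in> {1, -1} \<Longrightarrow>
      \<rho> (QD \<epsilon>') (\<rho> (K \<epsilon> j) v) = \<rho> (K \<epsilon> j) (\<rho> (QD \<epsilon>') v)"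
    and QD_X: "i \<in> {1..n} \<Longrightarrow> \<epsilon> \<in> {1, -1} \<Longrightarrow>
      \<rho> (QD 1) (\<rho> (X \<epsilon> i k) (\<rho> (QD (-1)) v)) = s (qq powi k) (\<rho> (X \<epsilon> i k) v)"
    and QD_H: "i \<in> {1..n} \<Longrightarrow> l \<noteq> 0 \<Longrightarrow>
      \<rho> (QD 1) (\<rho> (H i l) (\<rho> (QD (-1)) v)) = s (qq powi l) (\<rho> (H i l) v)"
    and K_X: "i \<in> {1..n} \<Longrightarrow> j \<in> {1..n} \<Longrightarrow> \<epsilon> \<in> {1, -1} \<Longrightarrow>
      \<rho> (K 1 i) (\<rho> (X \<epsilon> j k) (\<rho> (K (-1) i) v)) = s (qq powi (\<epsilon> * C i j)) (\<rho> (X \<epsilon> j k) v)"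
    and H_X: "i \<in> {1..n} \<Longrightarrow> j \<in> {1..n} \<Longrightarrow> \<epsilon> \<in> {1, -1} \<Longrightarrow> k \<noteq> 0 \<Longrightarrow>
      \<rho> (H i k) (\<rho> (X \<epsilon> j l) v) - \<rho> (X \<epsilon> j l) (\<rho> (H i k) v) =
        s (of_int \<epsilon> * (sqnum (C i j * k) / of_int k)) (gam \<rho> (- \<epsilon> * \<bar>k\<bar>) (\<rho> (X \<epsilon> j (k + l)) v))"
    and X_X: "i \<in> {1..n} \<Longrightarrow> j \<in> {1..n} \<Longrightarrow> \<epsilon> \<in> {1, -1} \<Longrightarrow>
      \<rho> (X \<epsilon> i (k + 1)) (\<rho> (X \<epsilon> j l) v)
        - s (qq powi (\<epsilon> * C i j)) (\<rho> (X \<epsilon> j l) (\<rho> (X \<epsilon> i (k + 1)) v)) =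
      s (qq powi (\<epsilon> * C i j)) (\<rho> (X \<epsilon> i k) (\<rho> (X \<epsilon> j (l + 1)) v))
        - \<rho> (X \<epsilon> j (l + 1)) (\<rho> (X \<epsilon> i k) v)"
    and Xp_Xm: "i \<in> {1..n} \<Longrightarrow> j \<in> {1..n} \<Longrightarrow>
      \<rho> (X 1 i k) (\<rho> (X (-1) j l) v) - \<rho> (X (-1) j l) (\<rho> (X 1 i k) v) =
        (if i = j
         then s (1 / (qq - qq powi (- 1)))
                (gam \<rho> (k - l) (psi s \<rho> i (k + l) v) - gam \<rho> (l - k) (phi s \<rho> i (k + l) v))
         else 0)"
    and Serre: "i \<in> {1..n} \<Longrightarrow> j \<in> {1..n} \<Longrightarrow> i \<noteq> j \<Longrightarrow> \<epsilon> \<in> {1, -1} \<Longrightarrow> m = nat (1 - C i j) \<Longrightarrow>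
      (\<Sum>\<sigma> | \<sigma> permutes {..<m}. \<Sum>r\<le>m.
         s ((-1) ^ r * sqbinom m r)
           (foldr (\<lambda>t. \<rho> (X \<epsilon> i (ls (\<sigma> t)))) [0..<r]
             (\<rho> (X \<epsilon> j k) (foldr (\<lambda>t. \<rho> (X \<epsilon> i (ls (\<sigma> t)))) [r..<m] v)))) = 0"

definition restricted :: "nat \<Rightarrow> (drinfeld_gen \<Rightarrow> 'l::zero \<Rightarrow> 'l) \<Rightarrow> bool" where
  "restricted n \<rho> \<longleftrightarrow>
     (\<forall>\<epsilon>\<in>{1, -1}. \<forall>i\<in>{1..n}. \<forall>v. \<exists>N. \<forall>r\<ge>N. \<rho> (X \<epsilon> i r) v = 0)"

text \<open>The current \<open>x\<^sub>i\<^sup>\<plusminus>(z)\<close>, the sum of the \<open>x\<^sub>i\<^sup>\<plusminus>(r) z^(-r-1)\<close>:\<close>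

definition current :: "(drinfeld_gen \<Rightarrow> 'l \<Rightarrow> 'l) \<Rightarrow> int \<Rightarrow> nat \<Rightarrow> 'l ser" where
  "current \<rho> \<epsilon> i = (\<lambda>m. \<rho> (X \<epsilon> i (- m - 1)))"

end

theory Submission
  imports Defs "HOL-Library.Groups_Big_Fun"
begin

text \<open>
  The relations between the currents have the form
  \<open>p(z\<^sub>2/z\<^sub>1) a(z\<^sub>1) b(z\<^sub>2) = g(z\<^sub>2/z\<^sub>1) b(z\<^sub>2) a(z\<^sub>1)\<close> with \<open>p(1) = 1\<close>, \<open>p(Q^k) \<noteq> 0\<close> for \<open>k \<ge> 0\<close>
  and an arbitrary polynomial \<open>g\<close>.  The left side is bounded below in \<open>z\<^sub>2\<close>, the right side in
  \<open>z\<^sub>1\<close>, so such a relation yields a limit product \<open>a(z)b(z)\<close>; it is moreover inherited by shifts,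
  by dilations and by limit products of series satisfying it pairwise, and it makes the limit
  product associative.  It is not inherited by sums, but since \<open>Q\<close>-derivatives are combinations of
  dilations, every homogeneous series of weight \<open>\<alpha>\<close> obtained from the generators is a linear
  combination of series built from them by these operations with dilations by at most \<open>Q^\<alpha>\<close>.
  Associativity of the modes is then the \<open>Q\<close>-Leibniz rule applied to associative limit products,
  and it also shows that the span of the monomials in the generators is closed under all products.
\<close>

section \<open>Pairing with the coefficients of a polynomial\<close>

context operator_series
begin

text \<open>Quasi-commutativity of pairs controls only two factors, whereas associativity of limit
  products compares two sums over one series in three variables. That series, multiplied by a
  polynomial in each ratio, has to be bounded below in every variable. A lower bound in a variable
  is visible only when the corresponding factor acts first on the given vector, and exchange
  relations can bring each of the three factors to that place. Sums destroy exchange relations: two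
  of them can be given the same p by multiplying, but then their right-hand polynomials differ in
  general. The values p(Q^k) enter because replacing b(z) by b(Q^k z) turns p(z) into p(Q^k
  z)/p(Q^k). For the currents x_i^- the polynomial is a multiple of 1 - q^(-a) z with a = a_ij, and
  its root q^a must avoid all q^(-2k) with k >= 0. This holds for a = 2 and a = -1, but not for a =
  0, nor for a = -2, which occurs only next to the affine node. For x_i^+ the root would be q^(-a),
  which is Q when a = 2.\<close>

lemma linear_iff_series:
  "Vector_Spaces.linear s s h \<longleftrightarrow> (\<forall>x y. h (x + y) = h x + h y) \<and> (\<forall>c x. h (s c x) = s c (h x))"
  by (auto simp: Vector_Spaces.linear_iff vector_space_axioms)

lemma linear_pres:
  assumes "Vector_Spaces.linear s s h"
  shows "h (x + y) = h x + h y" "h (s c x) = s c (h x)" "h 0 = 0" "h (- x) = - h x"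
    "h (x - y) = h x - h y" "h (sum f A) = (\<Sum>i\<in>A. h (f i))"
proof -
  interpret h: Vector_Spaces.linear s s h by fact
  show "h (x + y) = h x + h y" "h (s c x) = s c (h x)" "h 0 = 0" "h (- x) = - h x"
    "h (x - y) = h x - h y" "h (sum f A) = (\<Sum>i\<in>A. h (f i))"
    by (rule h.add h.scale h.zero h.neg h.diff h.sum)+
qed

text \<open>The linear extension of z^k -> \<open>f k\<close> to polynomials. Coefficient identities
  for products of polynomials then become nested pairings (\<open>pair_mult\<close>), and pairings
  in different ratios commute (\<open>pair_swap\<close>).\<close>

definition pair :: "'k poly \<Rightarrow> (nat \<Rightarrow> 'l) \<Rightarrow> 'l" where
  "pair p f = (\<Sum>k\<le>degree p. s (coeff p k) (f k))"

lemma pair_extend: "N \<ge> degree p \<Longrightarrow> pair p f = (\<Sum>k\<le>N. s (coeff p k) (f k))"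
  unfolding pair_def by (rule sum.mono_neutral_left) (auto simp: coeff_eq_0)

lemma pair_swap: "pair p (\<lambda>j. pair q (\<lambda>k. f j k)) = pair q (\<lambda>k. pair p (\<lambda>j. f j k))"
  unfolding pair_def
  by (simp add: scale_sum_right mult.commute) (rule sum.swap)

lemma pair_add_poly: "pair (p + q) f = pair p f + pair q f"
  using pair_extend[of "p+q" "max (degree p) (degree q)"]
    pair_extend[of p "max (degree p) (degree q)"] pair_extend[of q "max (degree p) (degree q)"]
  by (simp add: degree_add_le scale_left_distrib sum.distrib)

lemma pair_smult: "pair (smult c p) f = s c (pair p f)"
  using pair_extend[of "smult c p" "degree p"] pair_extend[of p "degree p"]
  by (simp add: degree_smult_le scale_sum_right)

lemma pair_0 [simp]: "pair 0 f = 0"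
  by (simp add: pair_def)

lemma pair_pCons: "pair (pCons c p) f = s c (f 0) + pair p (\<lambda>k. f (Suc k))"
  using pair_extend[of "pCons c p" "Suc (degree p)" f]
  by (simp only: degree_pCons_le sum.atMost_Suc_shift) (simp add: pair_def)

lemma pair_1 [simp]: "pair 1 f = f 0"
  by (simp add: pair_def)

lemma pair_mult: "pair (p * q) f = pair p (\<lambda>j. pair q (\<lambda>k. f (j + k)))"
  by (induction p arbitrary: f) (simp_all add: pair_pCons pair_add_poly pair_smult)

lemma pair_const: "pair p (\<lambda>_. v) = s (poly p 1) v"
  by (induction p) (simp_all add: pair_pCons scale_left_distrib)

text \<open>Substituting c z for z in the polynomial is the same as weighting the k-th term by c^k.
  This is how a dilation of one factor is absorbed into the polynomial.\<close>

lemma pair_pcompose: "pair (pcompose p [:0, c:]) f = pair p (\<lambda>k. s (c ^ k) (f k))"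
proof (induction p arbitrary: f)
  case (pCons a p)
  have "pair ([:0, c:] * r) f = s c (pair r (\<lambda>k. f (Suc k)))" for r
    by (simp add: pair_smult pair_pCons)
  then show ?case
    by (simp add: pcompose_pCons pair_add_poly pair_pCons pCons.IH)
       (simp add: pair_def scale_sum_right mult.commute mult.left_commute)
qed simp

lemma pair_add: "pair p (\<lambda>k. f k + g k) = pair p f + pair p g"
  by (simp add: pair_def scale_right_distrib sum.distrib)

lemma pair_scale: "pair p (\<lambda>k. s c (f k)) = s c (pair p f)"
  by (simp add: pair_def scale_sum_right mult.commute)

lemma linear_pair: "Vector_Spaces.linear s s h \<Longrightarrow> h (pair p f) = pair p (\<lambda>k. h (f k))"
  by (simp add: pair_def linear_pres)

lemma pair_neq_0E: assumes "pair p f \<noteq> 0" obtains k where "k \<le> degree p" "f k \<noteq> 0"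
proof -
  have "\<exists>k\<le>degree p. f k \<noteq> 0"
  proof (rule ccontr)
    assume "\<not> ?thesis"
    then have "pair p f = 0" by (auto simp: pair_def intro!: sum.neutral)
    then show False using assms by simp
  qed
  then show ?thesis using that by blast
qed

text \<open>\<open>Sum_any\<close> is 0 on infinite support, so every interchange of sums comes with
  a finiteness condition. Here one finite set serves all the finitely many k up to the
  degree.\<close>

lemma pair_Sum_any:
  assumes "\<And>k. finite {m. f k m \<noteq> 0}"
  shows "pair p (\<lambda>k. Sum_any (f k)) = Sum_any (\<lambda>m. pair p (\<lambda>k. f k m))"
proof -
  let ?A = "\<Union>k\<le>degree p. {m. f k m \<noteq> 0}"
  have fin: "finite ?A" using assms by auto
  have "Sum_any (\<lambda>m. pair p (\<lambda>k. f k m)) = (\<Sum>m\<in>?A. pair p (\<lambda>k. f k m))"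
    by (rule Sum_any.expand_superset[OF fin]) (auto elim!: pair_neq_0E)
  also have "\<dots> = pair p (\<lambda>k. \<Sum>m\<in>?A. f k m)"
    unfolding pair_def by (simp add: scale_sum_right sum.swap[of _ ?A])
  also have "\<dots> = pair p (\<lambda>k. Sum_any (f k))"
    unfolding pair_def
    by (intro sum.cong refl arg_cong2[where f = s] Sum_any.expand_superset[symmetric] fin) auto
  finally show ?thesis ..
qed

lemma linear_Sum_any:
  assumes "Vector_Spaces.linear s s h" "finite {m. f m \<noteq> 0}"
  shows "h (Sum_any f) = Sum_any (\<lambda>m. h (f m))"
proof -
  have "Sum_any (\<lambda>m. h (f m)) = (\<Sum>m | f m \<noteq> 0. h (f m))"
    by (rule Sum_any.expand_superset) (use assms in \<open>auto simp: linear_pres\<close>)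
  then show ?thesis using assms by (simp add: Sum_any.expand_set linear_pres)
qed

lemma Sum_any_shift: "Sum_any f = Sum_any (\<lambda>m::int. f (m + c))"
  by (rule Sum_any.reindex_cong[where l = "\<lambda>m. m + c"]) (auto simp: bij_def inj_def surj_def intro: exI[of _ "_ - c"])

section \<open>Multiplication by a polynomial in the ratio, and the diagonal\<close>

lemma mult_ratio_pair: "mult_ratio p F m n v = pair p (\<lambda>k. F (m + int k) (n - int k) v)"
  by (simp add: mult_ratio_def pair_def)

lemma mult_ratio_mult: "mult_ratio (p * q) F = mult_ratio p (mult_ratio q F)"
  by (simp add: fun_eq_iff mult_ratio_pair pair_mult algebra_simps)

lemma diag_Sum_any: "diag F n v = Sum_any (\<lambda>m. F m (n - m) v)"
  by (simp add: diag_def Sum_any.expand_set)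

lemma linear_scale_self: "Vector_Spaces.linear s s (s c)"
  by (simp add: linear_iff_series scale_right_distrib mult.commute)

lemma E_D:
  assumes "a \<in> E"
  shows "Vector_Spaces.linear s s (a n)" "\<exists>N. \<forall>n<N. a n v = 0"
  using assms by (auto simp: E_def)

lemma E_lower: "a \<in> E \<Longrightarrow> \<exists>N. \<forall>n. a n v \<noteq> 0 \<longrightarrow> N \<le> n"
  using E_D(2)[of a v] by (meson not_less)

lemma E2_D:
  assumes "F \<in> E2"
  shows "Vector_Spaces.linear s s (F m n)" "\<exists>M N. \<forall>m n. F m n v \<noteq> 0 \<longrightarrow> M \<le> m \<and> N \<le> n"
  using assms by (auto simp: E2_def)

lemma E2_finite_diag: assumes "F \<in> E2" shows "finite {m. F m (n - m) v \<noteq> 0}"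
proof -
  obtain M N where "\<forall>m n. F m n v \<noteq> 0 \<longrightarrow> M \<le> m \<and> N \<le> n" using E2_D(2)[OF assms] by blast
  then have "{m. F m (n - m) v \<noteq> 0} \<subseteq> {M..n - N}" by force
  then show ?thesis by (rule finite_subset) simp
qed

lemma E2_finite_diag_shift: assumes "F \<in> E2" shows "finite {m. F (m + i) (n - m) v \<noteq> 0}"
proof -
  have "(\<lambda>m. m + i) ` {m. F (m + i) (n - m) v \<noteq> 0} \<subseteq> {m. F m ((n + i) - m) v \<noteq> 0}" by auto
  then have "finite ((\<lambda>m. m + i) ` {m. F (m + i) (n - m) v \<noteq> 0})"
    using E2_finite_diag[OF assms] finite_subset by blast
  then show ?thesis by (rule finite_imageD) (auto simp: inj_on_def)
qed

lemma E2_add: assumes "F \<in> E2" "G \<in> E2" shows "F + G \<in> E2"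
proof -
  have "\<exists>M N. \<forall>m n. F m n v + G m n v \<noteq> 0 \<longrightarrow> M \<le> m \<and> N \<le> n" for v
  proof -
    obtain M N where 1: "\<forall>m n. F m n v \<noteq> 0 \<longrightarrow> M \<le> m \<and> N \<le> n" using E2_D(2)[OF assms(1)] by blast
    obtain M' N' where 2: "\<forall>m n. G m n v \<noteq> 0 \<longrightarrow> M' \<le> m \<and> N' \<le> n" using E2_D(2)[OF assms(2)] by blast
    show ?thesis
      by (rule exI[of _ "min M M'"], rule exI[of _ "min N N'"])
         (use 1 2 in \<open>metis add.right_neutral add_0 min.coboundedI1 min.coboundedI2\<close>)
  qed
  moreover have "Vector_Spaces.linear s s (\<lambda>v. F m n v + G m n v)" for m n
    using assms by (auto simp: E2_def linear_iff_series scale_right_distrib)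
  ultimately show ?thesis by (auto simp: E2_def plus_fun_def)
qed

lemma linear_pair_fun:
  "(\<And>k. Vector_Spaces.linear s s (f k)) \<Longrightarrow> Vector_Spaces.linear s s (\<lambda>v. pair p (\<lambda>k. f k v))"
  by (simp add: linear_iff_series pair_add pair_scale)

lemma E2_mult_ratio: assumes "F \<in> E2" shows "mult_ratio p F \<in> E2"
proof -
  have "\<exists>M N. \<forall>m n. mult_ratio p F m n v \<noteq> 0 \<longrightarrow> M \<le> m \<and> N \<le> n" for v
  proof -
    obtain M N where 1: "\<forall>m n. F m n v \<noteq> 0 \<longrightarrow> M \<le> m \<and> N \<le> n" using E2_D(2)[OF assms(1)] by blast
    show ?thesis
    proof (intro exI allI impI)
      fix m n assume "mult_ratio p F m n v \<noteq> 0"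
      then obtain k where "k \<le> degree p" "F (m + int k) (n - int k) v \<noteq> 0"
        by (auto simp: mult_ratio_pair elim: pair_neq_0E)
      then show "M - int (degree p) \<le> m \<and> N \<le> n" using 1 by force
    qed
  qed
  moreover have "Vector_Spaces.linear s s (mult_ratio p F m n)" for m n
    unfolding mult_ratio_pair[abs_def] by (intro linear_pair_fun E2_D assms)
  ultimately show ?thesis by (auto simp: E2_def)
qed

text \<open>A power of z2/z1 only moves coefficients along their antidiagonal, so the sum over the
  antidiagonal does not see it. What remains is the sum of the coefficients of p, that is
  p(1).\<close>

lemma diag_mult_ratio: assumes "F \<in> E2" shows "diag (mult_ratio p F) n v = s (poly p 1) (diag F n v)"
proof -
  have "diag (mult_ratio p F) n v = Sum_any (\<lambda>m. pair p (\<lambda>k. F (m + int k) (n - m - int k) v))"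
    by (simp add: diag_Sum_any mult_ratio_pair)
  also have "\<dots> = pair p (\<lambda>k. Sum_any (\<lambda>m. F (m + int k) (n - m - int k) v))"
    by (subst pair_Sum_any)
       (use E2_finite_diag_shift[OF assms, of "int k" "n - int k" v for k] in \<open>simp_all add: algebra_simps\<close>)
  also have "\<dots> = pair p (\<lambda>k. diag F n v)"
    using Sum_any_shift[of "\<lambda>m. F m (n - m) v" "int k" for k, symmetric]
    by (simp add: diag_Sum_any algebra_simps)
  finally show ?thesis by (simp add: pair_const)
qed

lemma diag_E: assumes "F \<in> E2" shows "diag F \<in> E"
proof -
  have "Vector_Spaces.linear s s (diag F n)" for n
    using E2_D(1)[OF assms] E2_finite_diag[OF assms]
    by (auto simp: linear_iff_series diag_Sum_any Sum_any.distrib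
        linear_Sum_any[OF linear_scale_self, symmetric])
  moreover have "\<exists>N. \<forall>n<N. diag F n v = 0" for v
  proof -
    obtain M N where 1: "\<forall>m n. F m n v \<noteq> 0 \<longrightarrow> M \<le> m \<and> N \<le> n" using E2_D(2)[OF assms] by blast
    have "diag F n v = 0" if "n < M + N" for n
    proof -
      have "F m (n - m) v = 0" for m using 1 that by force
      then show ?thesis by (simp add: diag_Sum_any)
    qed
    then show ?thesis by blast
  qed
  ultimately show ?thesis by (auto simp: E_def)
qed

end

section \<open>Limit products of operator-valued series\<close>

context operator_series
begin

definition ser_scale :: "'k \<Rightarrow> 'l ser \<Rightarrow> 'l ser" where
  "ser_scale c a = (\<lambda>n v. s c (a n v))"

sublocale ser: vector_space ser_scale
  by unfold_locales (auto simp: ser_scale_def fun_eq_iff scale_right_distrib scale_left_distrib)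

lemma subspace_E: "ser.subspace E"
proof (rule ser.subspaceI)
  fix a b assume ab: "a \<in> E" "b \<in> E"
  have "\<exists>N. \<forall>n<N. a n v + b n v = 0" for v
  proof -
    obtain M N where "\<forall>n<M. a n v = 0" "\<forall>n<N. b n v = 0"
      using ab E_D(2) by metis
    then have "\<forall>n<min M N. a n v + b n v = 0" by simp
    then show ?thesis by blast
  qed
  then show "a + b \<in> E"
    using ab by (auto simp: E_def linear_iff_series scale_right_distrib)
next
  fix c a assume a: "a \<in> E"
  then have "\<forall>v. \<exists>N. \<forall>n<N. s c (a n v) = 0" by (metis E_D(2) scale_zero_right)
  with a show "ser_scale c a \<in> E"
    by (auto simp: E_def linear_iff_series ser_scale_def scale_right_distrib mult.commute)
qed (simp add: E_def linear_iff_series)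

definition reg2 :: "'l ser2 \<Rightarrow> bool" where
  "reg2 F \<longleftrightarrow> (\<exists>p\<in>poly0. mult_ratio p F \<in> E2)"

text \<open>The choice of p is literally that of \<open>prod_hom\<close>, so that
  \<open>prod_hom_eq\<close> follows by unfolding.\<close>

definition lim2 :: "'l ser2 \<Rightarrow> 'l ser" where
  "lim2 F = diag (mult_ratio (SOME p. p \<in> poly0 \<and> mult_ratio p F \<in> E2) F)"

definition regular :: "'l ser \<Rightarrow> 'l ser \<Rightarrow> bool" where
  "regular a b = reg2 (prod2 a b)"

definition lim_prod :: "'l ser \<Rightarrow> 'l ser \<Rightarrow> 'l ser" where
  "lim_prod a b = lim2 (prod2 a b)"

lemma poly0_D: "p \<in> poly0 \<Longrightarrow> poly p 1 = 1" "p \<in> poly0 \<Longrightarrow> poly p (Q ^ n) \<noteq> 0"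
  by (auto simp: poly0_def)

lemma poly0_1 [simp]: "1 \<in> poly0"
  by (simp add: poly0_def)

lemma poly0_mult: "p \<in> poly0 \<Longrightarrow> q \<in> poly0 \<Longrightarrow> p * q \<in> poly0"
  by (simp add: poly0_def)

text \<open>At Q^n the new polynomial takes the value p(Q^(n+k))/p(Q^k), and n + k stays
  nonnegative.\<close>

lemma poly0_shift: "p \<in> poly0 \<Longrightarrow> smult (1 / poly p (Q ^ k)) (pcompose p [:0, Q ^ k:]) \<in> poly0"
  by (auto simp: poly0_def poly_pcompose simp flip: power_add)

lemma mult_ratio_commute: "mult_ratio p (mult_ratio q F) = mult_ratio q (mult_ratio p F)"
  by (simp add: mult.commute flip: mult_ratio_mult)

text \<open>Two admissible polynomials are compared through their product: a further factor from
  \<open>poly0\<close> leaves the diagonal unchanged, since its value at 1 is 1.\<close>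

lemma lim2_eq:
  assumes "p \<in> poly0" "mult_ratio p F \<in> E2"
  shows "lim2 F = diag (mult_ratio p F)"
proof -
  have *: "diag (mult_ratio q (mult_ratio r F)) = diag (mult_ratio r F)"
    if "mult_ratio r F \<in> E2" "q \<in> poly0" for q r
    using that by (simp add: fun_eq_iff diag_mult_ratio poly0_D)
  define q where "q = (SOME p. p \<in> poly0 \<and> mult_ratio p F \<in> E2)"
  have q: "q \<in> poly0 \<and> mult_ratio q F \<in> E2"
    unfolding q_def by (rule someI[of _ p]) (use assms in simp)
  show ?thesis
    unfolding lim2_def q_def[symmetric] using *[of q p] *[of p q] q assms
    by (metis mult_ratio_commute)
qed

lemma lim2_in_E: "reg2 F \<Longrightarrow> lim2 F \<in> E"
  by (auto simp: reg2_def lim2_eq intro: diag_E)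

lemma mult_ratio_add: "mult_ratio p (F + G) = mult_ratio p F + mult_ratio p G"
  by (simp add: fun_eq_iff mult_ratio_pair pair_add)

lemma diag_add: "F \<in> E2 \<Longrightarrow> G \<in> E2 \<Longrightarrow> diag (F + G) = diag F + diag G"
  by (simp add: fun_eq_iff diag_Sum_any Sum_any.distrib E2_finite_diag)

lemma reg2_add:
  assumes "reg2 F" "reg2 G"
  shows "reg2 (F + G)" "lim2 (F + G) = lim2 F + lim2 G"
proof -
  obtain p q where p: "p \<in> poly0" "mult_ratio p F \<in> E2" and q: "q \<in> poly0" "mult_ratio q G \<in> E2"
    using assms by (auto simp: reg2_def)
  have F: "mult_ratio (p * q) F \<in> E2" and G: "mult_ratio (p * q) G \<in> E2"
    using E2_mult_ratio[OF p(2), of q] E2_mult_ratio[OF q(2), of p]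
    by (simp_all add: mult_ratio_mult mult_ratio_commute)
  have pq: "p * q \<in> poly0" using p q by (simp add: poly0_mult)
  have FG: "mult_ratio (p * q) (F + G) \<in> E2"
    unfolding mult_ratio_add by (intro E2_add F G)
  show "reg2 (F + G)" using FG pq by (auto simp: reg2_def)
  show "lim2 (F + G) = lim2 F + lim2 G"
    using lim2_eq[OF pq F] lim2_eq[OF pq G] lim2_eq[OF pq FG] diag_add[OF F G]
    by (simp add: mult_ratio_add)
qed

text \<open>Common scheme for scalings, shifts and joint dilations: an operation that commutes with
  ratio multiplication can be carried out before or after the choice of p.\<close>

lemma lim2_transfer:
  assumes "reg2 F"
    and "\<And>p. mult_ratio p (h F) = h (mult_ratio p F)"
    and "\<And>G. G \<in> E2 \<Longrightarrow> h G \<in> E2"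
    and "\<And>G. G \<in> E2 \<Longrightarrow> diag (h G) = h' (diag G)"
  shows "reg2 (h F)" "lim2 (h F) = h' (lim2 F)"
proof -
  obtain p where p: "p \<in> poly0" "mult_ratio p F \<in> E2"
    using assms by (auto simp: reg2_def)
  have hp: "mult_ratio p (h F) \<in> E2" using assms(2,3) p by simp
  show "reg2 (h F)" using hp p by (auto simp: reg2_def)
  show "lim2 (h F) = h' (lim2 F)"
    using lim2_eq[OF p] lim2_eq[OF p(1) hp] assms(2,4) p by simp
qed

lemma E2_rescale:
  assumes "F \<in> E2" shows "(\<lambda>m n v. s (c m n) (F (m + i) (n + j) v)) \<in> E2"
proof -
  have "\<exists>M N. \<forall>m n. s (c m n) (F (m + i) (n + j) v) \<noteq> 0 \<longrightarrow> M \<le> m \<and> N \<le> n" for v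
  proof -
    obtain M N where "\<forall>m n. F m n v \<noteq> 0 \<longrightarrow> M \<le> m \<and> N \<le> n" using E2_D(2)[OF assms] by blast
    then have "\<forall>m n. s (c m n) (F (m + i) (n + j) v) \<noteq> 0 \<longrightarrow> M - i \<le> m \<and> N - j \<le> n"
      by fastforce
    then show ?thesis by blast
  qed
  moreover have "Vector_Spaces.linear s s (\<lambda>v. s (c m n) (F (m + i) (n + j) v))" for m n
    using E2_D(1)[OF assms] by (simp add: linear_iff_series scale_right_distrib mult.commute)
  ultimately show ?thesis by (auto simp: E2_def)
qed

lemma reg2_scale:
  assumes "reg2 F"
  shows "reg2 (\<lambda>m n v. s c (F m n v))" "lim2 (\<lambda>m n v. s c (F m n v)) = ser_scale c (lim2 F)"
proof -
  have "\<And>G. G \<in> E2 \<Longrightarrow> diag (\<lambda>m n v. s c (G m n v)) = ser_scale c (diag G)"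
    by (simp add: fun_eq_iff diag_Sum_any ser_scale_def linear_Sum_any[OF linear_scale_self] E2_finite_diag)
  from lim2_transfer[where h = "\<lambda>F m n v. s c (F m n v)" and h' = "ser_scale c", OF assms _ _ this]
  show "reg2 (\<lambda>m n v. s c (F m n v))" "lim2 (\<lambda>m n v. s c (F m n v)) = ser_scale c (lim2 F)"
    using E2_rescale[of _ "\<lambda>_ _. c" 0 0]
    by (auto simp: fun_eq_iff mult_ratio_pair pair_scale)
qed

definition shift :: "int \<Rightarrow> 'l ser \<Rightarrow> 'l ser" where
  "shift j a = (\<lambda>n. a (n + j))"

lemma reg2_shift:
  assumes "reg2 F"
  shows "reg2 (\<lambda>m n. F (m + i) (n + j))" "lim2 (\<lambda>m n. F (m + i) (n + j)) = shift (i + j) (lim2 F)"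
proof -
  have 1: "diag (\<lambda>m n. G (m + i) (n + j)) = shift (i + j) (diag G)" for G
    using Sum_any_shift[of "\<lambda>m. G m (n + (i + j) - m) v" i for n v]
    by (simp add: fun_eq_iff diag_Sum_any shift_def algebra_simps)
  have 2: "mult_ratio p (\<lambda>m n. F (m + i) (n + j)) = (\<lambda>m n. mult_ratio p F (m + i) (n + j))" for p
    by (simp add: fun_eq_iff mult_ratio_pair algebra_simps)
  show "reg2 (\<lambda>m n. F (m + i) (n + j))" "lim2 (\<lambda>m n. F (m + i) (n + j)) = shift (i + j) (lim2 F)"
    using lim2_transfer[OF assms, of "\<lambda>F m n. F (m + i) (n + j)" "shift (i + j)", OF 2 _ 1]
      E2_rescale[of _ "\<lambda>_ _. 1" i j] by simp_all
qed

lemma dilate_dilate: "dilate c (dilate d a) = dilate (c * d) a"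
  by (simp add: dilate_def fun_eq_iff power_int_mult_distrib)

lemma dilate_1 [simp]: "dilate 1 a = a"
  by (simp add: dilate_def)

text \<open>The factor c^(m+n) of a joint dilation of both variables is constant on antidiagonals,
  so ratio multiplication does not notice it.\<close>

lemma reg2_dilate:
  assumes "reg2 F" "c \<noteq> 0"
  shows "reg2 (\<lambda>m n v. s (c powi (m + n)) (F m n v))"
    "lim2 (\<lambda>m n v. s (c powi (m + n)) (F m n v)) = dilate c (lim2 F)"
proof -
  have 1: "diag (\<lambda>m n v. s (c powi (m + n)) (G m n v)) = dilate c (diag G)" if "G \<in> E2" for G
    using that
    by (simp add: fun_eq_iff diag_Sum_any dilate_def linear_Sum_any[OF linear_scale_self] E2_finite_diag)
  show "reg2 (\<lambda>m n v. s (c powi (m + n)) (F m n v))"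
    "lim2 (\<lambda>m n v. s (c powi (m + n)) (F m n v)) = dilate c (lim2 F)"
    using lim2_transfer[where h = "\<lambda>F m n v. s (c powi (m + n)) (F m n v)" and h' = "dilate c",
        OF assms(1) _ _ 1] E2_rescale[of _ "\<lambda>m n. c powi (m + n)" 0 0]
    by (auto simp: fun_eq_iff mult_ratio_pair pair_scale)
qed

section \<open>Limit products under linear operations, shifts and dilations\<close>

context
  fixes a b c :: "'l ser"
  assumes "regular a b"
begin

lemma lim_prod_in_E: "lim_prod a b \<in> E"
  using \<open>regular a b\<close> by (simp add: regular_def lim_prod_def lim2_in_E)

lemma regular_add_left:
  assumes "regular c b"
  shows "regular (a + c) b" "lim_prod (a + c) b = lim_prod a b + lim_prod c b"
proof -
  have "prod2 (a + c) b = prod2 a b + prod2 c b" by (simp add: fun_eq_iff prod2_def)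
  then show "regular (a + c) b" "lim_prod (a + c) b = lim_prod a b + lim_prod c b"
    using \<open>regular a b\<close> assms reg2_add unfolding regular_def lim_prod_def by auto
qed

lemma regular_add_right:
  assumes "regular a c" "a \<in> E"
  shows "regular a (b + c)" "lim_prod a (b + c) = lim_prod a b + lim_prod a c"
proof -
  have "prod2 a (b + c) = prod2 a b + prod2 a c"
    using E_D(1)[OF assms(2)] by (simp add: fun_eq_iff prod2_def linear_pres)
  then show "regular a (b + c)" "lim_prod a (b + c) = lim_prod a b + lim_prod a c"
    using \<open>regular a b\<close> assms reg2_add unfolding regular_def lim_prod_def by auto
qed

lemma regular_scale_left:
  shows "regular (ser_scale x a) b" "lim_prod (ser_scale x a) b = ser_scale x (lim_prod a b)"
  using \<open>regular a b\<close> reg2_scale[of "prod2 a b" x] unfolding regular_def lim_prod_def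
  by (simp_all add: prod2_def ser_scale_def)

lemma regular_scale_right:
  assumes "a \<in> E"
  shows "regular a (ser_scale x b)" "lim_prod a (ser_scale x b) = ser_scale x (lim_prod a b)"
  using \<open>regular a b\<close> reg2_scale[of "prod2 a b" x] E_D(1)[OF assms]
  unfolding regular_def lim_prod_def
  by (simp_all add: prod2_def ser_scale_def linear_pres)

lemma regular_shift:
  shows "regular (shift i a) (shift j b)"
    "lim_prod (shift i a) (shift j b) = shift (i + j) (lim_prod a b)"
  using \<open>regular a b\<close> reg2_shift[of "prod2 a b" i j] unfolding regular_def lim_prod_def
  by (simp_all add: prod2_def shift_def)

lemma regular_dilate:
  assumes "a \<in> E" "x \<noteq> 0"
  shows "regular (dilate x a) (dilate x b)"
    "lim_prod (dilate x a) (dilate x b) = dilate x (lim_prod a b)"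
  using \<open>regular a b\<close> reg2_dilate[of "prod2 a b" x] E_D(1)[OF assms(1)] assms(2)
  unfolding regular_def lim_prod_def
  by (simp_all add: prod2_def dilate_def linear_pres power_int_add)

text \<open>Dilating only the second variable changes the ratio, so p is replaced by the polynomial
  of \<open>poly0_shift\<close>. The limit is now taken at another point of the (z1, z2)-plane,
  hence no formula for it in terms of \<open>lim_prod a b\<close>.\<close>

lemma regular_dilate_right:
  assumes "a \<in> E" "Q \<noteq> 0"
  shows "regular a (dilate (Q ^ k) b)"
proof -
  obtain p where p: "p \<in> poly0" "mult_ratio p (prod2 a b) \<in> E2"
    using \<open>regular a b\<close> by (auto simp: regular_def reg2_def)
  let ?c = "1 / poly p (Q ^ k)"
  have "(Q ^ k) ^ j * (Q ^ k) powi (n - int j) = (Q ^ k) powi n" for j n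
    using assms(2) by (simp add: power_int_diff)
  then have "mult_ratio (smult ?c (pcompose p [:0, Q ^ k:])) (prod2 a (dilate (Q ^ k) b))
     = (\<lambda>m n v. s (?c * (Q ^ k) powi n) (mult_ratio p (prod2 a b) m n v))"
    using E_D(1)[OF assms(1)]
    by (simp add: fun_eq_iff mult_ratio_pair pair_smult pair_pcompose prod2_def dilate_def
        linear_pres pair_scale)
  moreover have "\<dots> \<in> E2"
    using E2_rescale[OF p(2), of "\<lambda>m n. ?c * (Q ^ k) powi n" 0 0] by simp
  ultimately show ?thesis
    using poly0_shift[OF p(1), of k] unfolding regular_def reg2_def by metis
qed

end

end

section \<open>Exchange relations\<close>

context operator_series
begin

definition exch_by :: "'k poly \<Rightarrow> 'k poly \<Rightarrow> 'l ser \<Rightarrow> 'l ser \<Rightarrow> bool" where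
  "exch_by p g a b \<longleftrightarrow> (\<forall>m n v. pair p (\<lambda>k. a (m + int k) (b (n - int k) v)) =
     pair g (\<lambda>k. b (n - int k) (a (m + int k) v)))"

definition exch :: "'l ser \<Rightarrow> 'l ser \<Rightarrow> bool" where
  "exch a b \<longleftrightarrow> (\<exists>p\<in>poly0. \<exists>g. exch_by p g a b)"

lemma exch_byD:
  "exch_by p g a b \<Longrightarrow> pair p (\<lambda>k. a (m + int k) (b (n - int k) v)) =
     pair g (\<lambda>k. b (n - int k) (a (m + int k) v))"
  by (simp add: exch_by_def)

lemma exch_by_E2:
  assumes "exch_by p g a b" "a \<in> E" "b \<in> E"
  shows "mult_ratio p (prod2 a b) \<in> E2"
proof -
  have "\<exists>M N. \<forall>m n. mult_ratio p (prod2 a b) m n v \<noteq> 0 \<longrightarrow> M \<le> m \<and> N \<le> n" for v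
  proof -
    obtain M where M: "\<forall>n. a n v \<noteq> 0 \<longrightarrow> M \<le> n" using E_lower[OF assms(2)] by blast
    obtain N where N: "\<forall>n. b n v \<noteq> 0 \<longrightarrow> N \<le> n" using E_lower[OF assms(3)] by blast
    show ?thesis
    proof (intro exI allI impI)
      fix m n assume nz: "mult_ratio p (prod2 a b) m n v \<noteq> 0"
      then obtain k where "a (m + int k) (b (n - int k) v) \<noteq> 0"
        by (auto simp: mult_ratio_pair prod2_def elim: pair_neq_0E)
      then have "b (n - int k) v \<noteq> 0"
        using E_D(1)[OF assms(2)] by (auto simp: linear_pres)
      then have n: "N \<le> n" using N by force
      from nz have "pair g (\<lambda>k. b (n - int k) (a (m + int k) v)) \<noteq> 0"
        using exch_byD[OF assms(1)] by (simp add: mult_ratio_pair prod2_def)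
      then obtain j where j: "j \<le> degree g" "b (n - int j) (a (m + int j) v) \<noteq> 0"
        by (auto elim: pair_neq_0E)
      then have "a (m + int j) v \<noteq> 0"
        using E_D(1)[OF assms(3)] by (auto simp: linear_pres)
      then show "M - int (degree g) \<le> m \<and> N \<le> n" using M j n by force
    qed
  qed
  moreover have "Vector_Spaces.linear s s (mult_ratio p (prod2 a b) m n)" for m n
    unfolding mult_ratio_pair[abs_def] prod2_def
    using E_D(1)[OF assms(2)] E_D(1)[OF assms(3)]
    by (intro linear_pair_fun) (auto simp: linear_iff_series)
  ultimately show ?thesis by (auto simp: E2_def)
qed

lemma exch_regular: "exch a b \<Longrightarrow> a \<in> E \<Longrightarrow> b \<in> E \<Longrightarrow> regular a b"
  unfolding exch_def regular_def reg2_def using exch_by_E2 by blast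

lemma exch_by_lim_prod:
  "exch_by p g a b \<Longrightarrow> p \<in> poly0 \<Longrightarrow> a \<in> E \<Longrightarrow> b \<in> E \<Longrightarrow>
    lim_prod a b = diag (mult_ratio p (prod2 a b))"
  unfolding lim_prod_def by (rule lim2_eq) (auto intro: exch_by_E2)

lemma exch_shift: "exch a b \<Longrightarrow> exch (shift i a) (shift j b)"
proof -
  assume "exch a b"
  then obtain p g where p: "p \<in> poly0" "exch_by p g a b" by (auto simp: exch_def)
  have "exch_by p g (shift i a) (shift j b)"
    unfolding exch_by_def
    using exch_byD[OF p(2), of "m + i" "n + j" for m n] by (simp add: shift_def algebra_simps)
  with p show ?thesis by (auto simp: exch_def)
qed

lemma exch_dilate:
  assumes "exch a b" "a \<in> E" "b \<in> E" "c \<noteq> 0"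
  shows "exch (dilate c a) (dilate c b)"
proof -
  obtain p g where p: "p \<in> poly0" "exch_by p g a b" using assms by (auto simp: exch_def)
  have "c powi (m + int k) * c powi (n - int k) = c powi (m + n)" for m n k
    using assms(4) by (simp flip: power_int_add)
  then have "exch_by p g (dilate c a) (dilate c b)"
    using assms E_D(1)[OF assms(2)] E_D(1)[OF assms(3)] exch_byD[OF p(2)]
    by (auto simp: exch_by_def dilate_def linear_pres pair_scale mult.commute)
  with p show ?thesis by (auto simp: exch_def)
qed

text \<open>Both polynomials are composed with Q^k z and divided by p(Q^k). The normalization at 1
  concerns p alone, so g may be divided by the same number.\<close>

lemma exch_dilate_right:
  assumes "exch a b" "a \<in> E" "Q \<noteq> 0"
  shows "exch a (dilate (Q ^ k) b)"
proof -
  obtain p g where p: "p \<in> poly0" "exch_by p g a b" using assms by (auto simp: exch_def)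
  let ?c = "1 / poly p (Q ^ k)"
  have pw: "(Q ^ k) ^ j * (Q ^ k) powi (n - int j) = (Q ^ k) powi n" for j n
    using assms(3) by (simp add: power_int_diff)
  have "exch_by (smult ?c (pcompose p [:0, Q ^ k:])) (smult ?c (pcompose g [:0, Q ^ k:]))
     a (dilate (Q ^ k) b)"
    using E_D(1)[OF assms(2)] exch_byD[OF p(2)]
    by (auto simp: exch_by_def pair_smult pair_pcompose dilate_def linear_pres pw pair_scale)
  with poly0_shift[OF p(1), of k] show ?thesis unfolding exch_def by blast
qed

section \<open>The identity series\<close>

definition one_ser :: "'l ser" where "one_ser = (\<lambda>n v. if n = 0 then v else 0)"

lemma one_ser_E: "one_ser \<in> E"
  by (auto simp: E_def one_ser_def linear_iff_series)

lemma dilate_one_ser [simp]: "dilate c one_ser = one_ser"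
  by (auto simp: dilate_def one_ser_def fun_eq_iff)

lemma exch_one_left: "a \<in> E \<Longrightarrow> exch one_ser a"
  unfolding exch_def
  by (intro bexI[of _ 1] exI[of _ 1]) (auto simp: exch_by_def one_ser_def E_D linear_pres(3)[OF E_D(1)])

lemma exch_one_right: "a \<in> E \<Longrightarrow> exch a one_ser"
  unfolding exch_def
  by (intro bexI[of _ 1] exI[of _ 1]) (auto simp: exch_by_def one_ser_def E_D linear_pres(3)[OF E_D(1)])

lemma lim_prod_one_left: assumes "a \<in> E" shows "lim_prod one_ser a = a"
proof -
  have "exch_by 1 1 one_ser a"
    by (auto simp: exch_by_def one_ser_def linear_pres(3)[OF E_D(1)[OF assms]])
  then have "lim_prod one_ser a = diag (mult_ratio 1 (prod2 one_ser a))"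
    using assms one_ser_E exch_by_lim_prod[OF _ poly0_1] by blast
  also have "\<dots> = a"
    by (simp add: fun_eq_iff diag_Sum_any mult_ratio_pair prod2_def one_ser_def Sum_any.delta)
  finally show ?thesis .
qed

lemma lim_prod_one_right: assumes "a \<in> E" shows "lim_prod a one_ser = a"
proof -
  have "exch_by 1 1 a one_ser"
    by (auto simp: exch_by_def one_ser_def linear_pres(3)[OF E_D(1)[OF assms]])
  then have "lim_prod a one_ser = diag (mult_ratio 1 (prod2 a one_ser))"
    using assms one_ser_E exch_by_lim_prod[OF _ poly0_1] by blast
  also have "\<dots> = a"
  proof -
    have "a m (if n - m = 0 then v else 0) = (if m = n then a m v else 0)" for m n v
      by (simp add: linear_pres(3)[OF E_D(1)[OF assms]])
    then show ?thesis
      by (simp add: fun_eq_iff diag_Sum_any mult_ratio_pair prod2_def one_ser_def Sum_any.delta)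
  qed
  finally show ?thesis .
qed

section \<open>Products of three series and associativity of limit products\<close>

lemma finite_pair: "(\<And>k. finite {m. f k m \<noteq> 0}) \<Longrightarrow> finite {m. pair p (\<lambda>k. f k m) \<noteq> 0}"
  by (rule finite_subset[of _ "\<Union>k\<le>degree p. {m. f k m \<noteq> 0}"]) (auto elim!: pair_neq_0E)

lemma pair_pair_Sum_any:
  assumes "\<And>j k. finite {m. f j k m \<noteq> 0}"
  shows "pair p (\<lambda>j. pair q (\<lambda>k. Sum_any (f j k))) =
    Sum_any (\<lambda>m. pair p (\<lambda>j. pair q (\<lambda>k. f j k m)))"
proof -
  have "pair q (\<lambda>k. Sum_any (f j k)) = Sum_any (\<lambda>m. pair q (\<lambda>k. f j k m))" for j
    by (rule pair_Sum_any) (rule assms)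
  then show ?thesis
    by (simp add: pair_Sum_any finite_pair[OF assms])
qed

text \<open>The coefficient of \<open>z\<^sub>1^m1 z\<^sub>2^m2 z\<^sub>3^m3\<close> in
  \<open>p(z\<^sub>2/z\<^sub>1) q(z\<^sub>3/z\<^sub>1) r(z\<^sub>3/z\<^sub>2) a(z\<^sub>1) b(z\<^sub>2) c(z\<^sub>3)\<close>:\<close>

definition prod3 :: "'k poly \<Rightarrow> 'k poly \<Rightarrow> 'k poly \<Rightarrow> 'l ser \<Rightarrow> 'l ser \<Rightarrow> 'l ser \<Rightarrow>
    int \<Rightarrow> int \<Rightarrow> int \<Rightarrow> 'l \<Rightarrow> 'l" where
  "prod3 p q r a b c m1 m2 m3 v = pair p (\<lambda>i. pair q (\<lambda>j. pair r (\<lambda>k.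
     a (m1 + int i + int j) (b (m2 - int i + int k) (c (m3 - int j - int k) v)))))"

text \<open>On the diagonal z1 = z2 = z the product q(z3/z1) r(z3/z2) becomes (q r)(z3/z). Here m is
  the exponent of the merged variable z and n that of z3.\<close>

lemma diag_left_expand:
  assumes "mult_ratio p (prod2 a b) \<in> E2" "D = diag (mult_ratio p (prod2 a b))"
  shows "pair (q * r) (\<lambda>k. D (m + int k) (c (n - int k) v)) =
    Sum_any (\<lambda>m1. prod3 p q r a b c m1 (m - m1) n v)"
proof -
  let ?F = "mult_ratio p (prod2 a b)"
  \<comment> \<open>Shifting m1 by j splits the exponent j + k of the merged variable: j is credited
    to z1 (from q) and k to z2 (from r).\<close>
  have D: "D (m + int (j + k)) w = Sum_any (\<lambda>m1. ?F (m1 + int j) (m + int k - m1) w)" for j k w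
    unfolding assms(2) diag_Sum_any
    by (subst Sum_any_shift[of _ "int j"]) (simp add: algebra_simps)
  have "pair (q * r) (\<lambda>k. D (m + int k) (c (n - int k) v)) = pair q (\<lambda>j. pair r (\<lambda>k.
      Sum_any (\<lambda>m1. ?F (m1 + int j) (m + int k - m1) (c (n - int (j + k)) v))))"
    unfolding pair_mult D ..
  also have "\<dots> = Sum_any (\<lambda>m1. pair q (\<lambda>j. pair r (\<lambda>k.
      ?F (m1 + int j) (m + int k - m1) (c (n - int (j + k)) v))))"
    by (rule pair_pair_Sum_any) (rule E2_finite_diag_shift[OF assms(1)])
  also have "\<dots> = Sum_any (\<lambda>m1. prod3 p q r a b c m1 (m - m1) n v)"
    unfolding prod3_def mult_ratio_pair prod2_def pair_swap[of q p] pair_swap[of r p]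
    by (simp add: algebra_simps)
  finally show ?thesis .
qed

text \<open>The counterpart with \<open>c\<close> acting last. The sum over m1 now stands inside
  \<open>c\<close>, so it has to be finite and is moved out by linearity.\<close>

lemma diag_left_expand':
  assumes "mult_ratio p (prod2 a b) \<in> E2" "D = diag (mult_ratio p (prod2 a b))" "c \<in> E"
  shows "pair (q * r) (\<lambda>k. c (n - int k) (D (m + int k) v)) =
    Sum_any (\<lambda>m1. pair p (\<lambda>i. pair q (\<lambda>j. pair r (\<lambda>k.
     c (n - int j - int k) (a (m1 + int i + int j) (b (m - m1 - int i + int k) v))))))"
proof -
  let ?F = "mult_ratio p (prod2 a b)"
  have D: "c l (D (m + int (j + k)) w) = Sum_any (\<lambda>m1. c l (?F (m1 + int j) (m + int k - m1) w))" for j k l w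
  proof -
    have "D (m + int (j + k)) w = Sum_any (\<lambda>m1. ?F (m1 + int j) (m + int k - m1) w)"
      unfolding assms(2) diag_Sum_any
      by (subst Sum_any_shift[of _ "int j"]) (simp add: algebra_simps)
    then show ?thesis
      using linear_Sum_any[OF E_D(1)[OF assms(3)] E2_finite_diag_shift[OF assms(1)]] by simp
  qed
  have fin: "finite {m1. c l (?F (m1 + int j) (m + int k - m1) w) \<noteq> 0}" for j k l w
    by (rule finite_subset[OF _ E2_finite_diag_shift[OF assms(1), of "int j" "m + int k" w]])
      (auto simp: linear_pres(3)[OF E_D(1)[OF assms(3)]])
  have "pair (q * r) (\<lambda>k. c (n - int k) (D (m + int k) v)) = pair q (\<lambda>j. pair r (\<lambda>k.
      Sum_any (\<lambda>m1. c (n - int (j + k)) (?F (m1 + int j) (m + int k - m1) v))))"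
    unfolding pair_mult D ..
  also have "\<dots> = Sum_any (\<lambda>m1. pair q (\<lambda>j. pair r (\<lambda>k.
      c (n - int (j + k)) (?F (m1 + int j) (m + int k - m1) v))))"
    by (rule pair_pair_Sum_any) (rule fin)
  also have "\<dots> = Sum_any (\<lambda>m1. pair p (\<lambda>i. pair q (\<lambda>j. pair r (\<lambda>k.
     c (n - int j - int k) (a (m1 + int i + int j) (b (m - m1 - int i + int k) v))))))"
    unfolding mult_ratio_pair prod2_def linear_pair[OF E_D(1)[OF assms(3)]]
      pair_swap[of q p] pair_swap[of r p]
    by (simp add: algebra_simps)
  finally show ?thesis .
qed

text \<open>Mirror image for the diagonal z2 = z3 = z, where p(z2/z1) q(z3/z1) becomes (p
  q)(z/z1).\<close>

lemma diag_right_expand: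
  assumes "mult_ratio r (prod2 b c) \<in> E2" "D = diag (mult_ratio r (prod2 b c))" "a \<in> E"
  shows "pair (p * q) (\<lambda>k. a (m + int k) (D (n - int k) v)) =
    Sum_any (\<lambda>m2. prod3 p q r a b c m m2 (n - m2) v)"
proof -
  let ?F = "mult_ratio r (prod2 b c)"
  have D: "a l (D (n - int (i + j)) w) = Sum_any (\<lambda>m2. a l (?F (m2 - int i) (n - int j - m2) w))" for i j l w
  proof -
    have "D (n - int (i + j)) w = Sum_any (\<lambda>m2. ?F (m2 - int i) (n - int j - m2) w)"
      unfolding assms(2) diag_Sum_any
      by (subst Sum_any_shift[of _ "- int i"]) (simp add: algebra_simps)
    then show ?thesis
      using linear_Sum_any[OF E_D(1)[OF assms(3)] E2_finite_diag_shift[OF assms(1), of "- int i"]] by simp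
  qed
  have fin: "finite {m2. a l (?F (m2 - int i) (n - int j - m2) w) \<noteq> 0}" for i j l w
    by (rule finite_subset[OF _ E2_finite_diag_shift[OF assms(1), of "- int i" "n - int j" w]])
      (auto simp: linear_pres(3)[OF E_D(1)[OF assms(3)]])
  have "pair (p * q) (\<lambda>k. a (m + int k) (D (n - int k) v)) = pair p (\<lambda>i. pair q (\<lambda>j.
      Sum_any (\<lambda>m2. a (m + int (i + j)) (?F (m2 - int i) (n - int j - m2) v))))"
    unfolding pair_mult D ..
  also have "\<dots> = Sum_any (\<lambda>m2. pair p (\<lambda>i. pair q (\<lambda>j.
      a (m + int (i + j)) (?F (m2 - int i) (n - int j - m2) v))))"
    by (rule pair_pair_Sum_any) (rule fin)
  also have "\<dots> = Sum_any (\<lambda>m2. prod3 p q r a b c m m2 (n - m2) v)"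
    unfolding mult_ratio_pair prod2_def linear_pair[OF E_D(1)[OF assms(3)]] prod3_def
    by (simp add: algebra_simps)
  finally show ?thesis .
qed

lemma diag_right_expand':
  assumes "mult_ratio r (prod2 b c) \<in> E2" "D = diag (mult_ratio r (prod2 b c))"
  shows "pair (p * q) (\<lambda>k. D (n - int k) (a (m + int k) v)) =
    Sum_any (\<lambda>m2. pair p (\<lambda>i. pair q (\<lambda>j. pair r (\<lambda>k.
      b (m2 - int i + int k) (c (n - m2 - int j - int k) (a (m + int i + int j) v))))))"
proof -
  let ?F = "mult_ratio r (prod2 b c)"
  have D: "D (n - int (i + j)) w = Sum_any (\<lambda>m2. ?F (m2 - int i) (n - int j - m2) w)" for i j w
    unfolding assms(2) diag_Sum_any
    by (subst Sum_any_shift[of _ "- int i"]) (simp add: algebra_simps)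
  have "pair (p * q) (\<lambda>k. D (n - int k) (a (m + int k) v)) = pair p (\<lambda>i. pair q (\<lambda>j.
      Sum_any (\<lambda>m2. ?F (m2 - int i) (n - int j - m2) (a (m + int (i + j)) v))))"
    unfolding pair_mult D ..
  also have "\<dots> = Sum_any (\<lambda>m2. pair p (\<lambda>i. pair q (\<lambda>j.
      ?F (m2 - int i) (n - int j - m2) (a (m + int (i + j)) v))))"
    by (rule pair_pair_Sum_any) 
       (use E2_finite_diag_shift[OF assms(1), of "- int i" for i] in simp)
  also have "\<dots> = Sum_any (\<lambda>m2. pair p (\<lambda>i. pair q (\<lambda>j. pair r (\<lambda>k.
      b (m2 - int i + int k) (c (n - m2 - int j - int k) (a (m + int i + int j) v))))))"
    unfolding mult_ratio_pair prod2_def by (simp add: algebra_simps)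
  finally show ?thesis .
qed

lemma prod3_move_bc:
  assumes "exch_by r h b c" "a \<in> E"
  shows "prod3 p q r a b c m1 m2 m3 v = pair p (\<lambda>i. pair q (\<lambda>j. pair h (\<lambda>k.
     a (m1 + int i + int j) (c (m3 - int j - int k) (b (m2 - int i + int k) v)))))"
  unfolding prod3_def by (simp add: exch_byD[OF assms(1)] flip: linear_pair[OF E_D(1)[OF assms(2)]])

text \<open>Only neighbours can be exchanged, so \<open>c\<close> passes \<open>b\<close> first and
  \<open>a\<close> next. Each exchange needs its own pairing innermost, which is what the uses of
  \<open>pair_swap\<close> arrange.\<close>

lemma prod3_move_c:
  assumes "exch_by q g a c" "exch_by r h b c" "a \<in> E"
  shows "prod3 p q r a b c m1 m2 m3 v = pair p (\<lambda>i. pair g (\<lambda>j. pair h (\<lambda>k.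
     c (m3 - int j - int k) (a (m1 + int i + int j) (b (m2 - int i + int k) v)))))"
proof -
  have "prod3 p q r a b c m1 m2 m3 v = pair p (\<lambda>i. pair h (\<lambda>k. pair q (\<lambda>j.
     a (m1 + int i + int j) (c (m3 - int k - int j) (b (m2 - int i + int k) v)))))"
    unfolding prod3_move_bc[OF assms(2,3)] pair_swap[of q h] by (simp add: algebra_simps)
  also have "\<dots> = pair p (\<lambda>i. pair h (\<lambda>k. pair g (\<lambda>j.
     c (m3 - int k - int j) (a (m1 + int i + int j) (b (m2 - int i + int k) v)))))"
    by (simp add: exch_byD[OF assms(1)])
  finally show ?thesis
    unfolding pair_swap[of h g] by (simp add: algebra_simps)
qed

text \<open>The opposite direction: \<open>a\<close> passes \<open>b\<close>, then \<open>c\<close>,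
  and ends up acting first on the vector.\<close>

lemma prod3_move_a:
  assumes "exch_by p g a b" "exch_by q h a c" "b \<in> E"
  shows "prod3 p q r a b c m1 m2 m3 v = pair g (\<lambda>i. pair h (\<lambda>j. pair r (\<lambda>k.
     b (m2 - int i + int k) (c (m3 - int j - int k) (a (m1 + int i + int j) v)))))"
proof -
  have "prod3 p q r a b c m1 m2 m3 v = pair q (\<lambda>j. pair r (\<lambda>k. pair p (\<lambda>i.
     a (m1 + int j + int i) (b (m2 + int k - int i) (c (m3 - int j - int k) v)))))"
    unfolding prod3_def pair_swap[of p q] pair_swap[of p r] by (simp add: algebra_simps)
  also have "\<dots> = pair q (\<lambda>j. pair r (\<lambda>k. pair g (\<lambda>i.
     b (m2 + int k - int i) (a (m1 + int j + int i) (c (m3 - int j - int k) v)))))"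
    by (simp add: exch_byD[OF assms(1)])
  also have "\<dots> = pair g (\<lambda>i. pair r (\<lambda>k. pair q (\<lambda>j.
     b (m2 + int k - int i) (a (m1 + int i + int j) (c (m3 - int k - int j) v)))))"
    unfolding pair_swap[of r g] pair_swap[of q g] pair_swap[of q r] by (simp add: algebra_simps)
  also have "\<dots> = pair g (\<lambda>i. pair r (\<lambda>k. pair h (\<lambda>j.
     b (m2 + int k - int i) (c (m3 - int k - int j) (a (m1 + int i + int j) v)))))"
    by (simp add: exch_byD[OF assms(2)] flip: linear_pair[OF E_D(1)[OF assms(3)]])
  finally show ?thesis
    unfolding pair_swap[of r h] by (simp add: algebra_simps)
qed

text \<open>Both sides of the relation expand to the same sum over the diagonal of z1 and z2, once
  with \<open>c\<close> acting first and once with \<open>c\<close> moved to the front. The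
  polynomial p stays in place throughout and keeps the limit of \<open>a\<close> and
  \<open>b\<close> meaningful.\<close>

lemma exch_by_lim_left:
  assumes "exch_by p f a b" "exch_by q g a c" "exch_by r h b c" "p \<in> poly0"
    "a \<in> E" "b \<in> E" "c \<in> E"
  shows "exch_by (q * r) (g * h) (lim_prod a b) c"
  unfolding exch_by_def
    diag_left_expand[OF exch_by_E2[OF assms(1,5,6)] exch_by_lim_prod[OF assms(1,4,5,6)]]
    diag_left_expand'[OF exch_by_E2[OF assms(1,5,6)] exch_by_lim_prod[OF assms(1,4,5,6)] assms(7)]
    prod3_move_c[OF assms(2,3,5)] by simp

lemma exch_by_lim_right:
  assumes "exch_by p f a b" "exch_by q g a c" "exch_by r h b c" "r \<in> poly0"
    "a \<in> E" "b \<in> E" "c \<in> E"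
  shows "exch_by (p * q) (f * g) a (lim_prod b c)"
  unfolding exch_by_def
    diag_right_expand[OF exch_by_E2[OF assms(3,6,7)] exch_by_lim_prod[OF assms(3,4,6,7)] assms(5)]
    diag_right_expand'[OF exch_by_E2[OF assms(3,6,7)] exch_by_lim_prod[OF assms(3,4,6,7)]]
    prod3_move_a[OF assms(1,2,6)] by simp

lemma exch_lim_left:
  assumes "exch a b" "exch a c" "exch b c" "a \<in> E" "b \<in> E" "c \<in> E"
  shows "exch (lim_prod a b) c"
  using assms exch_by_lim_left[OF _ _ _ _ assms(4-6)] unfolding exch_def by (metis poly0_mult)

lemma exch_lim_right:
  assumes "exch a b" "exch a c" "exch b c" "a \<in> E" "b \<in> E" "c \<in> E"
  shows "exch a (lim_prod b c)"
  using assms exch_by_lim_right[OF _ _ _ _ assms(4-6)] unfolding exch_def by (metis poly0_mult)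

text \<open>Each of the three bounds is read off from an ordering in which that factor acts first on
  v: the original one for \<open>c\<close>, that of \<open>prod3_move_a\<close> for
  \<open>a\<close>, that of \<open>prod3_move_bc\<close> for \<open>b\<close>.\<close>

lemma prod3_lower:
  assumes "exch_by p f a b" "exch_by q g a c" "exch_by r h b c" "a \<in> E" "b \<in> E" "c \<in> E"
  obtains M1 M2 M3 where "\<And>m1 m2 m3. prod3 p q r a b c m1 m2 m3 v \<noteq> 0 \<Longrightarrow> M1 \<le> m1 \<and> M2 \<le> m2 \<and> M3 \<le> m3"
proof -
  note z = linear_pres(3)[OF E_D(1)[OF assms(4)]] linear_pres(3)[OF E_D(1)[OF assms(5)]]
    linear_pres(3)[OF E_D(1)[OF assms(6)]]
  obtain A where A: "\<forall>n. a n v \<noteq> 0 \<longrightarrow> A \<le> n" using E_lower[OF assms(4)] by blast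
  obtain B where B: "\<forall>n. b n v \<noteq> 0 \<longrightarrow> B \<le> n" using E_lower[OF assms(5)] by blast
  obtain C where C: "\<forall>n. c n v \<noteq> 0 \<longrightarrow> C \<le> n" using E_lower[OF assms(6)] by blast
  show ?thesis
  proof (rule that, intro conjI)
    fix m1 m2 m3 assume nz: "prod3 p q r a b c m1 m2 m3 v \<noteq> 0"
    then obtain i j k where "a (m1 + int i + int j) (b (m2 - int i + int k) (c (m3 - int j - int k) v)) \<noteq> 0"
      unfolding prod3_def by (elim pair_neq_0E)
    then have "c (m3 - int j - int k) v \<noteq> 0" by (auto simp: z)
    then show "C \<le> m3" using C by force
    obtain i j k where "j \<le> degree g" "i \<le> degree f"
      "b (m2 - int i + int k) (c (m3 - int j - int k) (a (m1 + int i + int j) v)) \<noteq> 0"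
      using nz unfolding prod3_move_a[OF assms(1,2,5)] by (elim pair_neq_0E)
    moreover from this have "a (m1 + int i + int j) v \<noteq> 0" by (auto simp: z)
    ultimately show "A - int (degree f) - int (degree g) \<le> m1" using A by force
    obtain i j k where "k \<le> degree h"
      "a (m1 + int i + int j) (c (m3 - int j - int k) (b (m2 - int i + int k) v)) \<noteq> 0"
      using nz unfolding prod3_move_bc[OF assms(3,4)] by (elim pair_neq_0E)
    moreover from this have "b (m2 - int i + int k) v \<noteq> 0" by (auto simp: z)
    ultimately show "B - int (degree h) \<le> m2" using B by force
  qed
qed

text \<open>Both sides are the sum of the coefficients of one series in three variables over the plane
  \<open>m1 + m2 + m3 = n\<close>, where only finitely many of them are nonzero by \<open>prod3_lower\<close>.\<close>

theorem lim_prod_assoc: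
  assumes "exch a b" "exch a c" "exch b c" "a \<in> E" "b \<in> E" "c \<in> E"
  shows "lim_prod (lim_prod a b) c = lim_prod a (lim_prod b c)"
proof -
  obtain p f q g r h where pq: "p \<in> poly0" "q \<in> poly0" "r \<in> poly0" and
    ex: "exch_by p f a b" "exch_by q g a c" "exch_by r h b c"
    using assms unfolding exch_def by metis
  note abE = assms(4-6)
  have ab: "lim_prod a b \<in> E" and bc: "lim_prod b c \<in> E"
    using lim_prod_in_E exch_regular assms by blast+
  have L: "lim_prod (lim_prod a b) c n v =
      Sum_any (\<lambda>m. Sum_any (\<lambda>m1. prod3 p q r a b c m1 (m - m1) (n - m) v))" for n v
    unfolding exch_by_lim_prod[OF exch_by_lim_left[OF ex pq(1) abE] poly0_mult[OF pq(2,3)] ab abE(3)]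
      diag_Sum_any mult_ratio_pair prod2_def
      diag_left_expand[OF exch_by_E2[OF ex(1) abE(1,2)] exch_by_lim_prod[OF ex(1) pq(1) abE(1,2)]] ..
  have R: "lim_prod a (lim_prod b c) n v =
      Sum_any (\<lambda>m1. Sum_any (\<lambda>m2. prod3 p q r a b c m1 m2 (n - m1 - m2) v))" for n v
    unfolding exch_by_lim_prod[OF exch_by_lim_right[OF ex pq(3) abE] poly0_mult[OF pq(1,2)] abE(1) bc]
      diag_Sum_any mult_ratio_pair prod2_def
      diag_right_expand[OF exch_by_E2[OF ex(3) abE(2,3)] exch_by_lim_prod[OF ex(3) pq(3) abE(2,3)] abE(1)] ..
  have "lim_prod (lim_prod a b) c n v = lim_prod a (lim_prod b c) n v" for n v
  proof -
    let ?G = "\<lambda>m m1. prod3 p q r a b c m1 (m - m1) (n - m) v"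
    obtain M1 M2 M3 where M: "\<And>m1 m2 m3. prod3 p q r a b c m1 m2 m3 v \<noteq> 0 \<Longrightarrow> M1 \<le> m1 \<and> M2 \<le> m2 \<and> M3 \<le> m3"
      using prod3_lower[OF ex abE] by metis
    \<comment> \<open>In the coordinates m = m1 + m2 and m1 the three lower bounds confine the
      support to a finite box.\<close>
    have "{m. \<exists>m1. ?G m m1 \<noteq> 0} \<times> {m1. \<exists>m. ?G m m1 \<noteq> 0} \<subseteq> {M1 + M2..n - M3} \<times> {M1..n - M3 - M2}"
      using M by fastforce
    then have "Sum_any (\<lambda>m. Sum_any (?G m)) = Sum_any (\<lambda>m1. Sum_any (\<lambda>m. ?G m m1))"
      by (rule Sum_any.swap[rotated]) simp
    also have "\<dots> = Sum_any (\<lambda>m1. Sum_any (\<lambda>m2. prod3 p q r a b c m1 m2 (n - m1 - m2) v))"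
    proof -
      have "Sum_any (\<lambda>m. ?G m m1) = Sum_any (\<lambda>m2. prod3 p q r a b c m1 m2 (n - m1 - m2) v)" for m1
        using Sum_any_shift[of "\<lambda>m. ?G m m1" m1] by (simp add: algebra_simps)
      then show ?thesis by simp
    qed
    finally show ?thesis by (simp add: L R)
  qed
  then show ?thesis by (simp add: fun_eq_iff)
qed

end

section \<open>The \<open>Q\<close>-derivative and the \<open>Q\<close>-Leibniz rule\<close>

context operator_series
begin

lemma add_E: "a \<in> E \<Longrightarrow> b \<in> E \<Longrightarrow> a + b \<in> E"
  and scale_E: "a \<in> E \<Longrightarrow> ser_scale c a \<in> E" and diff_E: "a \<in> E \<Longrightarrow> b \<in> E \<Longrightarrow> a - b \<in> E"
  using subspace_E by (auto intro: ser.subspace_add ser.subspace_scale ser.subspace_diff)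

lemma dilate_E: assumes "a \<in> E" shows "dilate c a \<in> E"
proof -
  have "\<exists>N. \<forall>n<N. dilate c a n v = 0" for v
    using E_D(2)[OF assms, of v] by (auto simp: dilate_def)
  then show ?thesis
    using E_D(1)[OF assms] by (auto simp: E_def linear_iff_series dilate_def scale_right_distrib mult.commute)
qed

lemma shift_E: assumes "a \<in> E" shows "shift j a \<in> E"
proof -
  have "\<exists>N. \<forall>n<N. shift j a n v = 0" for v
  proof -
    obtain N where "\<forall>n<N. a n v = 0" using E_D(2)[OF assms] by blast
    then have "\<forall>n<N - j. shift j a n v = 0" by (simp add: shift_def)
    then show ?thesis by blast
  qed
  then show ?thesis using E_D(1)[OF assms] by (auto simp: E_def shift_def)
qed

lemma qderiv_eq: "qderiv a = ser_scale (1 / (Q - 1)) (shift 1 (dilate Q a - a))"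
  by (simp add: qderiv_def shift_def ser_scale_def fun_eq_iff)

lemma qderiv_E: "a \<in> E \<Longrightarrow> qderiv a \<in> E"
  unfolding qderiv_eq by (intro scale_E shift_E diff_E dilate_E)

lemma qderiv_pow_E: "a \<in> E \<Longrightarrow> (qderiv ^^ k) a \<in> E"
  by (induction k) (auto intro: qderiv_E)

lemma shift_diff: "shift j (a - b) = shift j a - shift j b"
  and shift_0: "shift 0 a = a"
  by (auto simp: shift_def ser_scale_def fun_eq_iff)

lemma dilate_add: "dilate c (a + b) = dilate c a + dilate c b"
  and dilate_scale: "dilate c (ser_scale x a) = ser_scale x (dilate c a)"
  and dilate_zero [simp]: "dilate c 0 = 0"
  by (auto simp: dilate_def ser_scale_def fun_eq_iff scale_right_distrib mult.commute)

lemma dilate_power: "dilate (Q ^ i) (dilate (Q ^ j) a) = dilate (Q ^ (i + j)) a"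
  by (simp add: dilate_dilate power_add)

lemma qderiv_add: "qderiv (a + b) = qderiv a + qderiv b"
  and qderiv_scale: "qderiv (ser_scale x a) = ser_scale x (qderiv a)"
  and qderiv_zero [simp]: "qderiv 0 = 0"
  by (auto simp: qderiv_def dilate_def ser_scale_def fun_eq_iff scale_right_distrib
      scale_right_diff_distrib mult.commute mult.left_commute)

lemma qderiv_sum: "qderiv (sum f A) = (\<Sum>i\<in>A. qderiv (f i))"
  using sum_comp_morphism[of qderiv f A, OF qderiv_zero qderiv_add] by (simp only: o_def)

lemma qderiv_pow_add: "(qderiv ^^ r) (a + b) = (qderiv ^^ r) a + (qderiv ^^ r) b"
  and qderiv_pow_scale: "(qderiv ^^ r) (ser_scale x a) = ser_scale x ((qderiv ^^ r) a)"
  and qderiv_pow_zero [simp]: "(qderiv ^^ r) 0 = 0"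
  by (induction r) (simp_all add: qderiv_add qderiv_scale)

lemma qderiv_dilate: "c \<noteq> 0 \<Longrightarrow> qderiv (dilate c a) = ser_scale c (dilate c (qderiv a))"
  by (simp add: qderiv_def dilate_def ser_scale_def fun_eq_iff scale_right_diff_distrib
      power_int_add mult_ac)

text \<open>Chain rule. These powers of c are the source of the powers of \<open>Q\<close> in the
  associativity axiom.\<close>

lemma qderiv_pow_dilate: "c \<noteq> 0 \<Longrightarrow> (qderiv ^^ k) (dilate c a) = ser_scale (c ^ k) (dilate c ((qderiv ^^ k) a))"
  by (induction k) (simp_all add: qderiv_dilate qderiv_scale mult.commute)

lemma qderiv_one_ser [simp]: "qderiv one_ser = 0"
  unfolding qderiv_eq by (simp add: shift_def ser_scale_def fun_eq_iff)

lemma regular_diff_left: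
  assumes "regular a c" "regular b c"
  shows "regular (a - b) c" "lim_prod (a - b) c = lim_prod a c - lim_prod b c"
proof -
  have "a - b = a + ser_scale (- 1) b" by simp
  then show "regular (a - b) c" "lim_prod (a - b) c = lim_prod a c - lim_prod b c"
    using regular_add_left[OF assms(1) regular_scale_left(1)[OF assms(2), of "- 1"]]
      regular_scale_left(2)[OF assms(2), of "- 1"] by simp_all
qed

lemma regular_diff_right:
  assumes "regular a b" "regular a c" "a \<in> E"
  shows "regular a (b - c)" "lim_prod a (b - c) = lim_prod a b - lim_prod a c"
proof -
  have "b - c = b + ser_scale (- 1) c" by simp
  then show "regular a (b - c)" "lim_prod a (b - c) = lim_prod a b - lim_prod a c"
    using regular_add_right[OF assms(1) regular_scale_right(1)[OF assms(2,3), of "- 1"] assms(3)]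
      regular_scale_right(2)[OF assms(2,3), of "- 1"] by simp_all
qed

lemma regular_shift_left:
  "regular a b \<Longrightarrow> regular (shift j a) b"
  "regular a b \<Longrightarrow> lim_prod (shift j a) b = shift j (lim_prod a b)"
  using regular_shift[of a b j 0] by (simp_all add: shift_0)

lemma regular_shift_right:
  "regular a b \<Longrightarrow> regular a (shift j b)"
  "regular a b \<Longrightarrow> lim_prod a (shift j b) = shift j (lim_prod a b)"
  using regular_shift[of a b 0 j] by (simp_all add: shift_0)

lemma regular_zero: "regular 0 b" "lim_prod 0 b = 0"
proof -
  have "mult_ratio 1 (prod2 0 b) = 0" by (simp add: fun_eq_iff mult_ratio_pair prod2_def)
  moreover have "0 \<in> E2" by (auto simp: E2_def linear_iff_series)
  moreover have "diag 0 = 0" by (simp add: fun_eq_iff diag_def)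
  ultimately have *: "mult_ratio 1 (prod2 0 b) \<in> E2" "diag (mult_ratio 1 (prod2 0 b)) = 0"
    by (simp_all only:)
  show "regular 0 b" using * poly0_1 unfolding regular_def reg2_def by blast
  show "lim_prod 0 b = 0" unfolding lim_prod_def using lim2_eq[OF poly0_1 *(1)] *(2) by simp
qed

lemma regular_zero_right: assumes "a \<in> E" shows "regular a 0" "lim_prod a 0 = 0"
proof -
  have "prod2 a 0 = prod2 0 0"
    using linear_pres(3)[OF E_D(1)[OF assms]] by (simp add: fun_eq_iff prod2_def)
  then show "regular a 0" "lim_prod a 0 = 0"
    using regular_zero[of 0] by (simp_all add: regular_def lim_prod_def)
qed

lemma lim_prod_sum_left:
  assumes "\<And>i. i \<in> A \<Longrightarrow> regular (f i) b"
  shows "regular (sum f A) b" "lim_prod (sum f A) b = (\<Sum>i\<in>A. lim_prod (f i) b)"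
proof -
  have "regular (sum f A) b \<and> lim_prod (sum f A) b = (\<Sum>i\<in>A. lim_prod (f i) b)"
    using assms(1)
    by (induction A rule: infinite_finite_induct)
      (auto simp: regular_zero regular_add_left)
  then show "regular (sum f A) b" "lim_prod (sum f A) b = (\<Sum>i\<in>A. lim_prod (f i) b)" by auto
qed

lemma prod_hom_eq: "prod_hom r a \<alpha> b =
    ser_scale (1 / qfact Q r) (lim_prod ((qderiv ^^ r) a) (dilate (Q ^ (\<alpha> + r)) b))"
  by (simp add: prod_hom_def ser_scale_def lim_prod_def lim2_def Let_def)

lemma quasi_comm_hom_eq: "quasi_comm_hom a \<alpha> b \<longleftrightarrow> regular a (dilate (Q ^ \<alpha>) b)"
  by (simp add: quasi_comm_hom_def regular_def reg2_def)

end

locale generic_operator_series = operator_series s Q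
  for s :: "'k::field \<Rightarrow> 'l::ab_group_add \<Rightarrow> 'l" and Q :: 'k +
  assumes Q_nz [simp]: "Q \<noteq> 0"
    and Q_not_root_of_unity: "n > 0 \<Longrightarrow> Q ^ n \<noteq> 1"
begin

lemma qnum_nz [simp]: "n > 0 \<Longrightarrow> qnum Q (int n) \<noteq> 0"
  using Q_not_root_of_unity[of n] Q_not_root_of_unity[of 1] by (simp add: qnum_def)

lemma qfact_0 [simp]: "qfact Q 0 = 1"
  by (simp add: qfact_def)

lemma qfact_Suc: "qfact Q (Suc r) = qnum Q (int (Suc r)) * qfact Q r"
  by (simp add: qfact_def mult.commute)

lemma qfact_nz [simp]: "qfact Q r \<noteq> 0"
  by (induction r) (simp_all add: qfact_Suc del: of_nat_Suc)

text \<open>The rule behind the Pascal recursion for the coefficients in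
  \<open>qderiv_pow_lim_prod\<close>.\<close>

lemma qnum_add: "qnum Q (int (l + m)) = qnum Q (int l) + Q ^ l * qnum Q (int m)"
  by (simp add: qnum_def power_add field_simps del: of_nat_add flip: add_divide_distrib)

lemma regular_qderiv_right:
  assumes "regular a b" "a \<in> E"
  shows "regular a (qderiv b)"
  unfolding qderiv_eq
  using regular_dilate_right[OF assms, of 1] assms
  by (intro regular_scale_right regular_shift_right regular_diff_right) auto

text \<open>The derivative contains a(Q z1) and a(z1). With b(Q z2) the former pair is a joint
  dilation and the latter a dilation on the right, so both limits exist. Iteration accounts for the
  r in the dilation \<open>Q ^ (\<alpha> + r)\<close> of \<open>prod_hom\<close>.\<close>

lemma regular_qderiv_left:
  assumes "regular a b" "a \<in> E"
  shows "regular (qderiv a) (dilate Q b)"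
  unfolding qderiv_eq
  using regular_dilate_right[OF assms, of 1] regular_dilate[OF assms Q_nz]
  by (intro regular_scale_left regular_shift_left regular_diff_left) auto

text \<open>The mixed product a(z) b(Qz) is subtracted and added in a(Qz) b(Qz) - a(z) b(z).\<close>

lemma qderiv_lim_prod:
  assumes ab: "regular a b" "a \<in> E"
  shows "qderiv (lim_prod a b) = lim_prod (qderiv a) (dilate Q b) + lim_prod a (qderiv b)"
proof -
  have b: "regular a (dilate Q b)" using regular_dilate_right[OF ab, of 1] by simp
  note d = regular_dilate[OF ab Q_nz]
  note l = regular_diff_left[OF d(1) b] and r = regular_diff_right[OF b ab]
  show ?thesis
    unfolding qderiv_eq regular_scale_left(2)[OF regular_shift_left(1)[OF l(1)]]
      regular_shift_left(2)[OF l(1)] l(2) d(2)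
      regular_scale_right(2)[OF regular_shift_right(1)[OF r(1)] ab(2)]
      regular_shift_right(2)[OF r(1)] r(2)
    by (simp add: shift_diff ser.scale_right_diff_distrib)
qed

lemma regular_qderiv_pow:
  assumes "regular a b" "a \<in> E"
  shows "regular ((qderiv ^^ l) a) (dilate (Q ^ l) ((qderiv ^^ k) b))"
proof (induction l)
  case 0
  show ?case by (induction k) (use assms regular_qderiv_right in auto)
next
  case (Suc l)
  from regular_qderiv_left[OF this qderiv_pow_E[OF assms(2)]]
  show ?case by (simp add: dilate_dilate)
qed

lemma qderiv_pow_lim_prod:
  assumes ab: "regular a b" "a \<in> E"
  shows "(qderiv ^^ S) (lim_prod a b) = (\<Sum>l\<le>S. ser_scale (qfact Q S / (qfact Q l * qfact Q (S - l)))
     (lim_prod ((qderiv ^^ l) a) (dilate (Q ^ l) ((qderiv ^^ (S - l)) b))))"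
proof (induction S)
  case (Suc S)
  define T where "T l k = lim_prod ((qderiv ^^ l) a) (dilate (Q ^ l) ((qderiv ^^ k) b))" for l k
  let ?f = "qfact Q"
  have DT: "qderiv (T l k) = T (Suc l) k + ser_scale (Q ^ l) (T l (Suc k))" for l k
    unfolding T_def
    using qderiv_lim_prod[OF regular_qderiv_pow[OF ab] qderiv_pow_E[OF ab(2)], of l k]
      regular_scale_right(2)[OF regular_qderiv_pow[OF ab] qderiv_pow_E[OF ab(2)], of l "Q ^ l" "Suc k"]
    by (simp add: dilate_dilate qderiv_dilate)
  let ?c = "\<lambda>l. ?f S / (?f l * ?f (Suc S - l))"
  have "(qderiv ^^ Suc S) (lim_prod a b)
      = (\<Sum>l\<le>S. ser_scale (?f S / (?f l * ?f (S - l))) (qderiv (T l (S - l))))"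
    by (simp add: Suc.IH qderiv_sum qderiv_scale T_def)
  also have "\<dots> = (\<Sum>l\<le>S. ser_scale (?f S / (?f l * ?f (S - l))) (T (Suc l) (S - l)))
      + (\<Sum>l\<le>S. ser_scale (?f S / (?f l * ?f (S - l)) * Q ^ l) (T l (Suc S - l)))"
    by (simp add: DT ser.scale_right_distrib sum.distrib Suc_diff_le)
  \<comment> \<open>This sum and the next are extended to l \<le> Suc S by one term each, at l = 0
    and at l = Suc S, which vanishes because \<open>qnum Q 0\<close> is 0. Then they have the same
    range and merge by \<open>qnum_add\<close>.\<close>
  also have "(\<Sum>l\<le>S. ser_scale (?f S / (?f l * ?f (S - l))) (T (Suc l) (S - l)))
      = (\<Sum>l\<le>Suc S. ser_scale (?c l * qnum Q (int l)) (T l (Suc S - l)))"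
    unfolding sum.atMost_Suc_shift
    by (simp add: qfact_Suc del: of_nat_Suc) (simp add: qnum_def)
  also have "(\<Sum>l\<le>S. ser_scale (?f S / (?f l * ?f (S - l)) * Q ^ l) (T l (Suc S - l)))
      = (\<Sum>l\<le>Suc S. ser_scale (?c l * (Q ^ l * qnum Q (int (Suc S - l)))) (T l (Suc S - l)))"
    by (simp add: Suc_diff_le qfact_Suc qnum_def[of _ 0] del: of_nat_Suc of_nat_diff)
  also have "(\<Sum>l\<le>Suc S. ser_scale (?c l * qnum Q (int l)) (T l (Suc S - l))) + \<dots> 
     = (\<Sum>l\<le>Suc S. ser_scale (?c l * qnum Q (int (Suc S))) (T l (Suc S - l)))"
    unfolding sum.distrib[symmetric]
  proof (intro sum.cong refl)
    fix l assume "l \<in> {..Suc S}"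
    then have "qnum Q (int (Suc S)) = qnum Q (int l) + Q ^ l * qnum Q (int (Suc S - l))"
      using qnum_add[of l "Suc S - l"] by simp
    then show "ser_scale (?c l * qnum Q (int l)) (T l (Suc S - l)) +
        ser_scale (?c l * (Q ^ l * qnum Q (int (Suc S - l)))) (T l (Suc S - l)) =
        ser_scale (?c l * qnum Q (int (Suc S))) (T l (Suc S - l))"
      by (simp only: distrib_left ser.scale_left_distrib)
  qed
  finally show ?case
    by (simp add: T_def qfact_Suc mult.commute del: of_nat_Suc)
qed simp

end

section \<open>Words in exchangeable series\<close>

context operator_series
begin

text \<open>The combination \<open>ser_scale x a + b\<close> is the form of an induction step over a
  span.\<close>

lemma lim_prod_linear_left:
  assumes "regular a c" "regular b c"
  shows "regular (ser_scale x a + b) c"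
    "lim_prod (ser_scale x a + b) c = ser_scale x (lim_prod a c) + lim_prod b c"
  using regular_add_left[OF regular_scale_left(1)[OF assms(1)] assms(2)] regular_scale_left(2)[OF assms(1)]
  by simp_all

lemma lim_prod_linear_right:
  assumes "regular a b" "regular a c" "a \<in> E"
  shows "regular a (ser_scale x b + c)"
    "lim_prod a (ser_scale x b + c) = ser_scale x (lim_prod a b) + lim_prod a c"
  using regular_add_right[OF regular_scale_right(1)[OF assms(1,3)] assms(2,3)]
    regular_scale_right(2)[OF assms(1,3)]
  by simp_all

lemma dilate_linear: "dilate c (ser_scale x a + b) = ser_scale x (dilate c a) + dilate c b"
  by (simp add: dilate_add dilate_scale)

end

locale exchangeable_series = generic_operator_series s Q
  for s :: "'k::field \<Rightarrow> 'l::ab_group_add \<Rightarrow> 'l" and Q :: 'k +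
  fixes I :: "'i set" and gen :: "'i \<Rightarrow> 'l ser"
  assumes gen_E: "i \<in> I \<Longrightarrow> gen i \<in> E"
    and gen_exch: "i \<in> I \<Longrightarrow> j \<in> I \<Longrightarrow> exch (gen i) (gen j)"
begin

text \<open>Induction rules produce eta-expanded sums of series, which these simp rules would break up
  into coefficients.\<close>

declare zero_fun_apply [simp del] plus_fun_apply [simp del]

text \<open>\<open>word a \<alpha>\<close>: the series \<open>a\<close> involves the generators only at arguments \<open>z Q^k\<close> with
  \<open>0 \<le> k \<le> \<alpha>\<close>, so that its exchange with \<open>b(z Q^\<alpha>)\<close> meets \<open>p\<close> only at nonnegative powers of \<open>Q\<close>.\<close>

inductive word :: "'l ser \<Rightarrow> nat \<Rightarrow> bool" where
  word_one: "word one_ser 0"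
| word_gen: "i \<in> I \<Longrightarrow> word (gen i) 0"
| word_dilate: "word a \<alpha> \<Longrightarrow> word (dilate (Q ^ j) a) (\<alpha> + j + k)"
| word_shift: "word a \<alpha> \<Longrightarrow> word (shift j a) \<alpha>"
| word_lim_prod: "word a \<alpha> \<Longrightarrow> word b \<beta> \<Longrightarrow> exch a (dilate (Q ^ \<alpha>) b) \<Longrightarrow>
    word (lim_prod a (dilate (Q ^ \<alpha>) b)) (\<alpha> + \<beta>)"

text \<open>This has to precede \<open>word_exch\<close>, so the rule \<open>word_lim_prod\<close>
  carries the exchange of its factors as a premise. Here it guarantees that the limit
  exists.\<close>

lemma word_E: "word a \<alpha> \<Longrightarrow> a \<in> E"
  by (induction rule: word.induct)
    (auto intro: one_ser_E gen_E dilate_E shift_E lim_prod_in_E exch_regular)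

text \<open>The case of weight 0 on the left, by induction on the right factor. It is the base for
  the induction on the left factor in \<open>word_exch\<close>.\<close>

lemma gen_word_exch: "word b \<beta> \<Longrightarrow> i \<in> I \<Longrightarrow> exch (gen i) b"
proof (induction rule: word.induct)
  case (word_shift b \<beta> j)
  then show ?case using exch_shift[of "gen i" b 0 j] by (simp add: shift_0)
next
  case (word_lim_prod b \<beta> c \<gamma>)
  then show ?case
    by (intro exch_lim_right) (auto intro: dilate_E word_E gen_E exch_dilate_right)
qed (auto intro: exch_one_right gen_E gen_exch exch_dilate_right)

lemma word_exch: "word a \<alpha> \<Longrightarrow> word b \<beta> \<Longrightarrow> exch a (dilate (Q ^ \<alpha>) b)"
proof (induction arbitrary: b \<beta> rule: word.induct)
  case word_one
  then show ?case by (auto intro: exch_one_left dilate_E word_E)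
next
  case (word_gen i)
  then show ?case by (auto intro: gen_word_exch)
next
  case (word_dilate a \<alpha> j k)
  have a: "a \<in> E" and b: "b \<in> E" using word_dilate word_E by auto
  \<comment> \<open>The dilation of b by \<open>\<alpha> + j + k\<close> is split: \<alpha> comes
    from the induction hypothesis, k from a dilation on the right, and j is shared with a.\<close>
  have "exch a (dilate (Q ^ k) (dilate (Q ^ \<alpha>) b))"
    by (rule exch_dilate_right[OF word_dilate.IH[OF word_dilate.prems] a Q_nz])
  then have "exch (dilate (Q ^ j) a) (dilate (Q ^ j) (dilate (Q ^ k) (dilate (Q ^ \<alpha>) b)))"
    by (intro exch_dilate) (auto intro: a b dilate_E)
  then show ?case by (simp add: dilate_power add_ac)
next
  case (word_shift a \<alpha> j)
  then show ?case using exch_shift[of a "dilate (Q ^ \<alpha>) b" j 0] by (simp add: shift_0)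
next
  case (word_lim_prod a \<alpha> a' \<alpha>')
  have E: "a \<in> E" "a' \<in> E" "b \<in> E" using word_lim_prod word_E by auto
  have "exch a (dilate (Q ^ \<alpha>') (dilate (Q ^ \<alpha>) b))"
    by (rule exch_dilate_right[OF word_lim_prod.IH(1)[OF word_lim_prod.prems] E(1) Q_nz])
  moreover have "exch (dilate (Q ^ \<alpha>) a') (dilate (Q ^ \<alpha>) (dilate (Q ^ \<alpha>') b))"
    using word_lim_prod E by (intro exch_dilate) (auto intro: dilate_E)
  ultimately show ?case
    using word_lim_prod.hyps E
    by (intro exch_lim_left) (auto intro: dilate_E simp: dilate_power add.commute)
qed

definition U :: "nat \<Rightarrow> 'l ser set" where
  "U \<alpha> = ser.span {a. word a \<alpha>}"

lemma U_closed [intro]: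
  "0 \<in> U \<alpha>" "a \<in> U \<alpha> \<Longrightarrow> b \<in> U \<alpha> \<Longrightarrow> a + b \<in> U \<alpha>" "a \<in> U \<alpha> \<Longrightarrow> ser_scale c a \<in> U \<alpha>"
  unfolding U_def by (auto intro: ser.span_zero ser.span_add ser.span_scale)

lemma word_U: "word a \<alpha> \<Longrightarrow> a \<in> U \<alpha>"
  unfolding U_def by (auto intro: ser.span_base)

lemma U_E: "a \<in> U \<alpha> \<Longrightarrow> a \<in> E"
proof -
  have "ser.span {a. word a \<alpha>} \<subseteq> E"
    by (rule ser.span_minimal) (auto intro: word_E subspace_E)
  then show "a \<in> U \<alpha> \<Longrightarrow> a \<in> E" by (auto simp: U_def)
qed

lemma U_induct [consumes 1, case_names zero step]:
  assumes "a \<in> U \<alpha>" "P 0"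
    and "\<And>c a b. word a \<alpha> \<Longrightarrow> b \<in> U \<alpha> \<Longrightarrow> P b \<Longrightarrow> P (ser_scale c a + b)"
  shows "P a"
proof -
  have "a \<in> U \<alpha> \<and> P a"
    using assms(1) unfolding U_def
  proof (induction rule: ser.span_induct_alt)
    case base
    then show ?case using assms(2) by (auto intro: ser.span_zero)
  next
    case (step c x y)
    then show ?case using assms(3)[of x y c] unfolding U_def
      by (auto intro: ser.span_add ser.span_scale ser.span_base)
  qed
  then show ?thesis ..
qed

text \<open>Unlike \<open>exch\<close>, existence of the limit is linear in each factor, so it
  extends from words to their span, here first in \<open>a\<close> with \<open>b\<close> a word,
  then in \<open>b\<close>.\<close>

lemma U_lim_prod:
  assumes "a \<in> U \<alpha>" "b \<in> U \<beta>"
  shows "regular a (dilate (Q ^ \<alpha>) b)" "lim_prod a (dilate (Q ^ \<alpha>) b) \<in> U (\<alpha> + \<beta>)"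
proof -
  note aE = U_E[OF assms(1)]
  have *: "regular a (dilate (Q ^ \<alpha>) b) \<and> lim_prod a (dilate (Q ^ \<alpha>) b) \<in> U (\<alpha> + \<beta>)"
    if "word b \<beta>" for b
    using assms(1)
  proof (induction rule: U_induct)
    case zero
    then show ?case by (auto simp: regular_zero)
  next
    case (step c x y)
    have ex: "exch x (dilate (Q ^ \<alpha>) b)" using word_exch step that by blast
    then have reg: "regular x (dilate (Q ^ \<alpha>) b)"
      by (intro exch_regular dilate_E) (use word_E step that in auto)
    moreover have "lim_prod x (dilate (Q ^ \<alpha>) b) \<in> U (\<alpha> + \<beta>)"
      using step that ex by (intro word_U word_lim_prod) auto
    ultimately show ?case
      using lim_prod_linear_left[OF reg] step.IH by auto
  qed
  have "regular a (dilate (Q ^ \<alpha>) b) \<and> lim_prod a (dilate (Q ^ \<alpha>) b) \<in> U (\<alpha> + \<beta>)"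
    using assms(2)
  proof (induction rule: U_induct)
    case zero
    then show ?case by (auto simp: regular_zero_right[OF aE])
  next
    case (step c x y)
    then show ?case
      using lim_prod_linear_right[OF _ _ aE, of "dilate (Q ^ \<alpha>) x" "dilate (Q ^ \<alpha>) y" c] *[of x]
      by (auto simp: dilate_linear)
  qed
  then show "regular a (dilate (Q ^ \<alpha>) b)" "lim_prod a (dilate (Q ^ \<alpha>) b) \<in> U (\<alpha> + \<beta>)" by auto
qed

lemma U_lim_prod_dilate:
  assumes "a \<in> U \<alpha>" "b \<in> U \<beta>" "c \<in> U \<gamma>"
  shows "regular (lim_prod a (dilate (Q ^ \<alpha>) b)) (dilate (Q ^ (\<alpha> + \<beta>)) c)"
    "regular a (dilate (Q ^ \<alpha>) (lim_prod b (dilate (Q ^ \<beta>) c)))"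
    "regular (dilate (Q ^ \<alpha>) b) (dilate (Q ^ (\<alpha> + \<beta>)) c)"
proof -
  show "regular (lim_prod a (dilate (Q ^ \<alpha>) b)) (dilate (Q ^ (\<alpha> + \<beta>)) c)"
    by (rule U_lim_prod(1)[OF U_lim_prod(2)[OF assms(1,2)] assms(3)])
  show "regular a (dilate (Q ^ \<alpha>) (lim_prod b (dilate (Q ^ \<beta>) c)))"
    by (rule U_lim_prod(1)[OF assms(1) U_lim_prod(2)[OF assms(2,3)]])
  show "regular (dilate (Q ^ \<alpha>) b) (dilate (Q ^ (\<alpha> + \<beta>)) c)"
    using regular_dilate(1)[OF U_lim_prod(1)[OF assms(2,3)] U_E[OF assms(2)], of "Q ^ \<alpha>"]
    by (simp add: dilate_power)
qed

text \<open>\<open>lim_prod_assoc\<close> applies to words. Since all limits involved exist on the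
  spans, the identity extends linearly in \<open>a\<close>, \<open>b\<close> and \<open>c\<close>,
  in this order.\<close>

lemma U_lim_prod_assoc:
  assumes a: "a \<in> U \<alpha>" and b: "b \<in> U \<beta>" and c: "c \<in> U \<gamma>"
  shows "lim_prod (lim_prod a (dilate (Q ^ \<alpha>) b)) (dilate (Q ^ (\<alpha> + \<beta>)) c) =
    lim_prod a (dilate (Q ^ \<alpha>) (lim_prod b (dilate (Q ^ \<beta>) c)))"
proof -
  let ?A = "dilate (Q ^ \<alpha>)" and ?B = "dilate (Q ^ \<beta>)" and ?AB = "dilate (Q ^ (\<alpha> + \<beta>))"
  let ?P = "\<lambda>a b c. lim_prod (lim_prod a (?A b)) (?AB c) = lim_prod a (?A (lim_prod b (?B c)))"
  have 1: "?P a b c" if a: "word a \<alpha>" and b: "word b \<beta>" and c: "word c \<gamma>" for a b c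
  proof -
    have E: "a \<in> E" "b \<in> E" "c \<in> E" using that word_E by auto
    have bc: "exch b (?B c)" using word_exch b c by blast
    have "exch (?A b) (?A (?B c))" "exch a (dilate (Q ^ \<beta>) (?A c))"
      using exch_dilate[OF bc E(2) dilate_E[OF E(3)], of "Q ^ \<alpha>"]
        exch_dilate_right[OF word_exch[OF a c] E(1) Q_nz]
      by simp_all
    then have "lim_prod (lim_prod a (?A b)) (?AB c) = lim_prod a (lim_prod (?A b) (?A (?B c)))"
      using lim_prod_assoc[of a "?A b" "?AB c"] E word_exch[OF a b]
      by (auto simp: dilate_power add.commute intro: dilate_E)
    then show ?thesis
      using regular_dilate(2)[OF exch_regular[OF bc E(2) dilate_E[OF E(3)]] E(2), of "Q ^ \<alpha>"] by simp
  qed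
  have 2: "?P a b c" if "word b \<beta>" "word c \<gamma>" for b c
    using a
  proof (induction rule: U_induct)
    case zero
    then show ?case by (simp only: regular_zero)
  next
    case (step x a' a)
    note U = word_U[OF step(1)] step(2) word_U[OF that(1)] word_U[OF that(2)]
    show ?case
      using step.IH 1[OF step(1) that]
      by (simp only: lim_prod_linear_left U_lim_prod[OF U(1,3)] U_lim_prod[OF U(2,3)]
          U_lim_prod_dilate[OF U(1,3,4)] U_lim_prod_dilate[OF U(2,3,4)])
  qed
  have 3: "?P a b c" if "word c \<gamma>" for c
    using b
  proof (induction rule: U_induct)
    case zero
    then show ?case by (simp only: regular_zero dilate_zero regular_zero_right U_E[OF a])
  next
    case (step x b' b)
    note U = word_U[OF step(1)] step(2) a word_U[OF that]
    show ?case
      using step.IH 2[OF step(1) that]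
      by (simp only: lim_prod_linear_left lim_prod_linear_right dilate_linear
          U_lim_prod[OF U(1,4)] U_lim_prod[OF U(2,4)] U_lim_prod[OF U(3,1)] U_lim_prod[OF U(3,2)]
          U_lim_prod_dilate[OF U(3,1,4)] U_lim_prod_dilate[OF U(3,2,4)] U_E[OF a])
  qed
  show ?thesis
    using c
  proof (induction rule: U_induct)
    case zero
    then show ?case
      by (simp only: dilate_zero regular_zero_right U_E[OF a] U_E[OF b] lim_prod_in_E[OF U_lim_prod(1)[OF a b]])
  next
    case (step x c' c)
    note U = word_U[OF step(1)] step(2)
    show ?case
      using step.IH 3[OF step(1)]
      by (simp only: lim_prod_linear_right dilate_linear
          U_lim_prod[OF b U(1)] U_lim_prod[OF b U(2)]
          U_lim_prod_dilate[OF a b U(1)] U_lim_prod_dilate[OF a b U(2)]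
          U_E[OF a] U_E[OF b] lim_prod_in_E[OF U_lim_prod(1)[OF a b]])
  qed
qed

lemma U_qderiv: "a \<in> U \<alpha> \<Longrightarrow> qderiv a \<in> U (Suc \<alpha>)"
proof (induction rule: U_induct)
  case zero
  then show ?case by (simp only: qderiv_zero U_closed)
next
  case (step c x y)
  \<comment> \<open>The rule \<open>word_dilate\<close> may raise the weight beyond the dilation, so
    x(Qz) (j = 1, k = 0) and x(z) (j = 0, k = 1) are words of the same weight.\<close>
  have "shift 1 (dilate (Q ^ 1) x) \<in> U (Suc \<alpha>)" "shift 1 (dilate (Q ^ 0) x) \<in> U (Suc \<alpha>)"
    using word_dilate[OF step(1), of 1 0] word_dilate[OF step(1), of 0 1]
    by (auto intro!: word_U word_shift)
  then have "qderiv x \<in> U (Suc \<alpha>)"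
    unfolding qderiv_eq shift_diff U_def by (intro ser.span_scale ser.span_diff) simp_all
  then show ?case using step.IH by (auto simp: qderiv_add qderiv_scale)
qed

lemma U_qderiv_pow: "a \<in> U \<alpha> \<Longrightarrow> (qderiv ^^ r) a \<in> U (\<alpha> + r)"
  by (induction r) (auto intro: U_qderiv)

lemma U_prod_hom: "a \<in> U \<alpha> \<Longrightarrow> b \<in> U \<beta> \<Longrightarrow> prod_hom r a \<alpha> b \<in> U (\<alpha> + \<beta> + r)"
  using U_lim_prod(2)[OF U_qderiv_pow, of a \<alpha> b \<beta> r] by (auto simp: prod_hom_eq add_ac)

lemma prod_hom_zero_left: "prod_hom r 0 \<alpha> b = 0"
  and prod_hom_zero_right: "a \<in> E \<Longrightarrow> prod_hom r a \<alpha> 0 = 0"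
  by (simp_all only: prod_hom_eq qderiv_pow_zero regular_zero dilate_zero regular_zero_right
      qderiv_pow_E ser.scale_zero_right)

lemma prod_hom_linear_left:
  assumes "a \<in> U \<alpha>" "a' \<in> U \<alpha>" "b \<in> U \<beta>"
  shows "prod_hom r (ser_scale x a + a') \<alpha> b = ser_scale x (prod_hom r a \<alpha> b) + prod_hom r a' \<alpha> b"
  unfolding prod_hom_eq qderiv_pow_add qderiv_pow_scale
    lim_prod_linear_left(2)[OF U_lim_prod(1)[OF U_qderiv_pow[OF assms(1)] assms(3)]
      U_lim_prod(1)[OF U_qderiv_pow[OF assms(2)] assms(3)]]
  by (simp add: ser.scale_right_distrib mult.commute)

lemma prod_hom_linear_right:
  assumes "a \<in> U \<alpha>" "b \<in> U \<beta>" "b' \<in> U \<beta>"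
  shows "prod_hom r a \<alpha> (ser_scale x b + b') = ser_scale x (prod_hom r a \<alpha> b) + prod_hom r a \<alpha> b'"
  unfolding prod_hom_eq dilate_linear
    lim_prod_linear_right(2)[OF U_lim_prod(1)[OF U_qderiv_pow[OF assms(1)] assms(2)]
      U_lim_prod(1)[OF U_qderiv_pow[OF assms(1)] assms(3)] U_E[OF U_qderiv_pow[OF assms(1)]]]
  by (simp add: ser.scale_right_distrib mult.commute)

section \<open>Iterated products of homogeneous series\<close>

lemma qbinom_eq: "qbinom Q (int (R + l)) l = qfact Q (R + l) / (qfact Q R * qfact Q l)"
proof -
  have "(\<Prod>i<l. qnum Q (int (R + l) - int i)) * qfact Q R = qfact Q (R + l)"
  proof (induction l)
    case (Suc l)
    have "(\<Prod>i<Suc l. qnum Q (int (R + Suc l) - int i))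
      = qnum Q (int (Suc (R + l))) * (\<Prod>i<l. qnum Q (int (R + l) - int i))"
      by (simp only: prod.lessThan_Suc_shift) (simp add: algebra_simps)
    then show ?case using Suc.IH by (simp add: qfact_Suc mult.assoc del: of_nat_Suc)
  qed simp
  then show ?thesis by (simp add: qbinom_def field_simps)
qed

text \<open>The associativity axiom for the modes r = - R - 1 and s = - S - 1. The Leibniz rule
  distributes the S derivatives over the inner product, the chain rule takes
  \<open>Q ^ (\<alpha> + R)\<close> out of the S - l derivatives falling on \<open>b\<close>, and
  each summand is reassociated.\<close>

lemma prod_hom_assoc:
  assumes a: "a \<in> U \<alpha>" and b: "b \<in> U \<beta>" and c: "c \<in> U \<gamma>"
  shows "prod_hom S (prod_hom R a \<alpha> b) (\<alpha> + \<beta> + R) c =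
    (\<Sum>l\<le>S. ser_scale (qbinom Q (int (R + l)) l * (Q ^ (\<alpha> + R)) ^ (S - l))
       (prod_hom (R + l) a \<alpha> (prod_hom (S - l) b \<beta> c)))"
proof -
  let ?f = "qfact Q"
  let ?a = "\<lambda>l. (qderiv ^^ (R + l)) a" and ?b = "\<lambda>l. (qderiv ^^ (S - l)) b"
  let ?c = "dilate (Q ^ (\<alpha> + \<beta> + R + S)) c"
  have aU: "?a l \<in> U (\<alpha> + R + l)" for l
    using U_qderiv_pow[OF a, of "R + l"] by (simp add: add_ac)
  have bU: "?b l \<in> U (\<beta> + (S - l))" for l using U_qderiv_pow[OF b] by simp
  have reg0: "regular ((qderiv ^^ R) a) (dilate (Q ^ (\<alpha> + R)) b)"
    using U_lim_prod(1)[OF U_qderiv_pow[OF a] b] .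
  have D: "(qderiv ^^ S) (lim_prod ((qderiv ^^ R) a) (dilate (Q ^ (\<alpha> + R)) b)) =
     (\<Sum>l\<le>S. ser_scale (?f S / (?f l * ?f (S - l)) * (Q ^ (\<alpha> + R)) ^ (S - l))
       (lim_prod (?a l) (dilate (Q ^ (\<alpha> + R + l)) (?b l))))"
    unfolding qderiv_pow_lim_prod[OF reg0 qderiv_pow_E[OF U_E[OF a]]]
  proof (intro sum.cong refl)
    fix l
    have "(qderiv ^^ l) ((qderiv ^^ R) a) = ?a l"
      using funpow_add[of l R qderiv] by (simp add: add.commute[of l R])
    moreover have "dilate (Q ^ l) ((qderiv ^^ (S - l)) (dilate (Q ^ (\<alpha> + R)) b)) =
        ser_scale ((Q ^ (\<alpha> + R)) ^ (S - l)) (dilate (Q ^ (\<alpha> + R + l)) (?b l))"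
      by (simp add: qderiv_pow_dilate dilate_scale dilate_power add_ac)
    ultimately show "ser_scale (?f S / (?f l * ?f (S - l)))
        (lim_prod ((qderiv ^^ l) ((qderiv ^^ R) a))
          (dilate (Q ^ l) ((qderiv ^^ (S - l)) (dilate (Q ^ (\<alpha> + R)) b)))) =
        ser_scale (?f S / (?f l * ?f (S - l)) * (Q ^ (\<alpha> + R)) ^ (S - l))
         (lim_prod (?a l) (dilate (Q ^ (\<alpha> + R + l)) (?b l)))"
      using regular_scale_right(2)[OF U_lim_prod(1)[OF aU bU] U_E[OF aU]] by simp
  qed
  have T: "regular (lim_prod (?a l) (dilate (Q ^ (\<alpha> + R + l)) (?b l))) ?c \<and>
     lim_prod (lim_prod (?a l) (dilate (Q ^ (\<alpha> + R + l)) (?b l))) ?c =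
      ser_scale (?f (R + l) * ?f (S - l)) (prod_hom (R + l) a \<alpha> (prod_hom (S - l) b \<beta> c))"
    if "l \<le> S" for l
  proof -
    \<comment> \<open>The dilation of \<open>c\<close> is the same for all l: a derivative taken
      from \<open>b\<close> is given to \<open>a\<close>, and the total weight does not
      change.\<close>
    have e: "\<alpha> + R + l + (\<beta> + (S - l)) = \<alpha> + \<beta> + R + S" using that by simp
    have r: "regular (?a l) (dilate (Q ^ (\<alpha> + R + l)) (lim_prod (?b l) (dilate (Q ^ (\<beta> + (S - l))) c)))"
      using U_lim_prod_dilate(2)[OF aU bU c] .
    have "prod_hom (R + l) a \<alpha> (prod_hom (S - l) b \<beta> c) = ser_scale (1 / (?f (R + l) * ?f (S - l)))
       (lim_prod (?a l) (dilate (Q ^ (\<alpha> + R + l)) (lim_prod (?b l) (dilate (Q ^ (\<beta> + (S - l))) c))))"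
      unfolding prod_hom_eq dilate_scale
      using regular_scale_right(2)[OF r U_E[OF aU]] by (simp add: add_ac)
    then show ?thesis
      using U_lim_prod_assoc[OF aU bU c, of l l, unfolded e] U_lim_prod_dilate(1)[OF aU bU c, of l l, unfolded e]
      by simp
  qed
  have "prod_hom S (prod_hom R a \<alpha> b) (\<alpha> + \<beta> + R) c = ser_scale (1 / (?f S * ?f R))
     (lim_prod ((qderiv ^^ S) (lim_prod ((qderiv ^^ R) a) (dilate (Q ^ (\<alpha> + R)) b))) ?c)"
  proof -
    have "(qderiv ^^ S) (lim_prod ((qderiv ^^ R) a) (dilate (Q ^ (\<alpha> + R)) b)) \<in> U (\<alpha> + \<beta> + R + S)"
      using U_qderiv_pow[OF U_lim_prod(2)[OF U_qderiv_pow[OF a] b], of S R] by (simp add: add_ac)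
    from regular_scale_left(2)[OF U_lim_prod(1)[OF this c]]
    show ?thesis by (simp add: prod_hom_eq qderiv_pow_scale)
  qed
  also have "\<dots> = ser_scale (1 / (?f S * ?f R)) (\<Sum>l\<le>S. ser_scale (?f S / (?f l * ?f (S - l)) * (Q ^ (\<alpha> + R)) ^ (S - l))
       (lim_prod (lim_prod (?a l) (dilate (Q ^ (\<alpha> + R + l)) (?b l))) ?c))"
    unfolding D using T
    by (subst lim_prod_sum_left) (auto simp: regular_scale_left intro!: sum.cong)
  \<comment> \<open>Per summand, S!/(l! (S-l)!) times (R+l)! (S-l)! divided by S! R! leaves
    (R+l)!/(R! l!), all in \<open>Q\<close>-factorials.\<close>
  also have "\<dots> = (\<Sum>l\<le>S. ser_scale (qbinom Q (int (R + l)) l * (Q ^ (\<alpha> + R)) ^ (S - l))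
       (prod_hom (R + l) a \<alpha> (prod_hom (S - l) b \<beta> c)))"
    unfolding ser.scale_sum_right using T
    by (intro sum.cong refl) (simp add: qbinom_eq del: of_nat_add)
  finally show ?thesis .
qed

end

section \<open>Products in \<open>\<E>(L) \<otimes> F[t]\<close>\<close>

context exchangeable_series
begin

lemma coeff_et_scale': "coeff (et_scale c A) \<alpha> = ser_scale c (coeff A \<alpha>)"
  by (simp add: coeff_et_scale ser_scale_def)

lemma et_scale_monom: "et_scale c (monom a \<alpha>) = monom (ser_scale c a) \<alpha>"
  by (rule poly_eqI) (simp add: coeff_et_scale')

text \<open>The exponent of t bounds the dilations inside the series, so the dilation prescribed by
  the product in \<open>nprod\<close> is exactly the one that \<open>U_lim_prod\<close> asks
  for.\<close>

definition Ut :: "'l ser poly set" where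
  "Ut = {A. \<forall>\<alpha>. coeff A \<alpha> \<in> U \<alpha>}"

lemma coeff_Ut: "A \<in> Ut \<Longrightarrow> coeff A \<alpha> \<in> U \<alpha>"
  by (simp add: Ut_def)

lemma monom_Ut: "a \<in> U \<alpha> \<Longrightarrow> monom a \<alpha> \<in> Ut"
  by (auto simp: Ut_def)

lemma subspace_Ut: "et.subspace Ut"
  by (rule et.subspaceI) (auto simp: Ut_def coeff_et_scale')

lemma Ut_closed: "A \<in> Ut \<Longrightarrow> B \<in> Ut \<Longrightarrow> A + B \<in> Ut" "A \<in> Ut \<Longrightarrow> et_scale c A \<in> Ut" "0 \<in> Ut"
  using subspace_Ut by (auto intro: et.subspace_add et.subspace_scale et.subspace_0)

lemma Ut_Et: "Ut \<subseteq> Et"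
  by (auto simp: Ut_def Et_def intro: U_E)

lemma Ut_induct [consumes 1, case_names zero add monom]:
  assumes "A \<in> Ut" "P 0" "\<And>A B. A \<in> Ut \<Longrightarrow> B \<in> Ut \<Longrightarrow> P A \<Longrightarrow> P B \<Longrightarrow> P (A + B)"
    "\<And>a \<alpha>. a \<in> U \<alpha> \<Longrightarrow> P (monom a \<alpha>)"
  shows "P A"
proof -
  have "(\<Sum>i\<le>n. monom (coeff A i) i) \<in> Ut \<and> P (\<Sum>i\<le>n. monom (coeff A i) i)" for n
  proof (induction n)
    case 0
    then show ?case using assms(4)[OF coeff_Ut[OF assms(1)]] monom_Ut[OF coeff_Ut[OF assms(1)]] by simp
  next
    case (Suc n)
    moreover note assms(4)[OF coeff_Ut[OF assms(1)], of "Suc n"] monom_Ut[OF coeff_Ut[OF assms(1)], of "Suc n"]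
    ultimately show ?case unfolding sum.atMost_Suc using Ut_closed(1) assms(3) by blast
  qed
  from this[of "degree A"] show ?thesis by (simp add: poly_as_sum_of_monoms)
qed

lemma nprod_neg: "nprod (- int R - 1) A B = (\<Sum>\<alpha>\<le>degree A. \<Sum>\<beta>\<le>degree B.
    monom (prod_hom R (coeff A \<alpha>) \<alpha> (coeff B \<beta>)) (\<alpha> + \<beta> + R))"
  by (simp add: nprod_def)

lemma nprod_nonneg: "k \<ge> 0 \<Longrightarrow> nprod k A B = 0"
  by (simp add: nprod_def)

lemma negative_int_cases: obtains "k \<ge> 0" | R where "k = - int R - 1"
  by (cases "k \<ge> 0") (auto intro: that(2)[of "nat (- k - 1)"])

lemma nprod_extend:
  assumes "A \<in> Ut" "degree A \<le> M" "degree B \<le> N"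
  shows "nprod (- int R - 1) A B = (\<Sum>\<alpha>\<le>M. \<Sum>\<beta>\<le>N.
    monom (prod_hom R (coeff A \<alpha>) \<alpha> (coeff B \<beta>)) (\<alpha> + \<beta> + R))"
proof -
  have E: "coeff A \<alpha> \<in> E" for \<alpha> using coeff_Ut[OF assms(1)] by (rule U_E)
  have "(\<Sum>\<beta>\<le>degree B. monom (prod_hom R (coeff A \<alpha>) \<alpha> (coeff B \<beta>)) (\<alpha> + \<beta> + R)) =
    (\<Sum>\<beta>\<le>N. monom (prod_hom R (coeff A \<alpha>) \<alpha> (coeff B \<beta>)) (\<alpha> + \<beta> + R))" for \<alpha>
    by (rule sum.mono_neutral_left)
       (use assms in \<open>auto simp: coeff_eq_0 prod_hom_zero_right[OF E]\<close>)
  then show ?thesis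
    unfolding nprod_neg
    by simp (rule sum.mono_neutral_left, use assms in \<open>auto simp: coeff_eq_0 prod_hom_zero_left\<close>)
qed

lemma nprod_linear_left:
  assumes "A \<in> Ut" "A' \<in> Ut" "B \<in> Ut"
  shows "nprod k (et_scale x A + A') B = et_scale x (nprod k A B) + nprod k A' B"
proof (cases k rule: negative_int_cases)
  case (2 R)
  let ?A = "et_scale x A + A'"
  define M where "M = max (degree ?A) (max (degree A) (degree A'))"
  have M: "degree ?A \<le> M" "degree A \<le> M" "degree A' \<le> M" by (auto simp: M_def)
  have U: "?A \<in> Ut" using assms by (auto intro: Ut_closed)
  show ?thesis
    unfolding 2 nprod_extend[OF U M(1) order_refl] nprod_extend[OF assms(1) M(2) order_refl]
      nprod_extend[OF assms(2) M(3) order_refl]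
    by (simp add: coeff_et_scale' prod_hom_linear_left[OF assms[THEN coeff_Ut]] et.scale_sum_right
        et_scale_monom sum.distrib flip: add_monom)
qed (simp add: nprod_nonneg)

lemma nprod_linear_right:
  assumes "A \<in> Ut" "B \<in> Ut" "B' \<in> Ut"
  shows "nprod k A (et_scale x B + B') = et_scale x (nprod k A B) + nprod k A B'"
proof (cases k rule: negative_int_cases)
  case (2 R)
  let ?B = "et_scale x B + B'"
  define M where "M = max (degree ?B) (max (degree B) (degree B'))"
  have M: "degree ?B \<le> M" "degree B \<le> M" "degree B' \<le> M" by (auto simp: M_def)
  show ?thesis
    unfolding 2 nprod_extend[OF assms(1) order_refl M(1)] nprod_extend[OF assms(1) order_refl M(2)]
      nprod_extend[OF assms(1) order_refl M(3)]
    by (simp add: coeff_et_scale' prod_hom_linear_right[OF assms[THEN coeff_Ut]] et.scale_sum_right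
        et_scale_monom sum.distrib flip: add_monom)
qed (simp add: nprod_nonneg)

lemma nprod_zero_left: "B \<in> Ut \<Longrightarrow> nprod k 0 B = 0"
  using nprod_linear_left[of 0 0 B k 1] Ut_closed(3) by simp

lemma nprod_zero_right: "A \<in> Ut \<Longrightarrow> nprod k A 0 = 0"
  using nprod_linear_right[of A 0 0 k 1] Ut_closed(3) by simp

lemma nprod_add_left: "A \<in> Ut \<Longrightarrow> A' \<in> Ut \<Longrightarrow> B \<in> Ut \<Longrightarrow> nprod k (A + A') B = nprod k A B + nprod k A' B"
  using nprod_linear_left[of A A' B k 1] by simp

lemma nprod_add_right: "A \<in> Ut \<Longrightarrow> B \<in> Ut \<Longrightarrow> B' \<in> Ut \<Longrightarrow> nprod k A (B + B') = nprod k A B + nprod k A B'"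
  using nprod_linear_right[of A B B' k 1] by simp

lemma nprod_scale_left: "A \<in> Ut \<Longrightarrow> B \<in> Ut \<Longrightarrow> nprod k (et_scale x A) B = et_scale x (nprod k A B)"
  using nprod_linear_left[of A 0 B k x] Ut_closed(3) by (simp add: nprod_zero_left)

lemma nprod_scale_right: "A \<in> Ut \<Longrightarrow> B \<in> Ut \<Longrightarrow> nprod k A (et_scale x B) = et_scale x (nprod k A B)"
  using nprod_linear_right[of A B 0 k x] Ut_closed(3) by (simp add: nprod_zero_right)

lemma nprod_monom:
  assumes "a \<in> U \<alpha>" "b \<in> U \<beta>"
  shows "nprod (- int R - 1) (monom a \<alpha>) (monom b \<beta>) = monom (prod_hom R a \<alpha> b) (\<alpha> + \<beta> + R)"
proof -
  have "monom (prod_hom R (coeff (monom a \<alpha>) i) i (coeff (monom b \<beta>) j)) (i + j + R) =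
    (if i = \<alpha> then if j = \<beta> then monom (prod_hom R a \<alpha> b) (\<alpha> + \<beta> + R) else 0 else 0)" for i j
    by (simp add: prod_hom_zero_left prod_hom_zero_right U_E[OF assms(1)])
  moreover have "(\<Sum>j\<le>\<beta>. if i = \<alpha> then if j = \<beta> then c else 0 else 0) = (if i = \<alpha> then c else 0)"
    for i and c :: "'l ser poly" by simp
  ultimately show ?thesis
    unfolding nprod_extend[OF monom_Ut[OF assms(1)] degree_monom_le degree_monom_le]
    by (simp only:) simp
qed

lemma nprod_Ut: "A \<in> Ut \<Longrightarrow> B \<in> Ut \<Longrightarrow> nprod k A B \<in> Ut"
proof (cases k rule: negative_int_cases)
  case (2 R)
  assume "A \<in> Ut" "B \<in> Ut"
  then show "nprod k A B \<in> Ut"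
    unfolding 2 nprod_neg
    by (intro et.subspace_sum[OF subspace_Ut] monom_Ut U_prod_hom coeff_Ut)
qed (simp add: nprod_nonneg Ut_closed)

lemma nprod_assoc:
  assumes a: "a \<in> U \<alpha>" and B: "B \<in> Ut" and C: "C \<in> Ut"
  shows "nprod (- int S - 1) (nprod (- int R - 1) (monom a \<alpha>) B) C =
    (\<Sum>l\<le>S. et_scale (qbinom Q (int (R + l)) l * (Q ^ (\<alpha> + R)) ^ (S - l))
       (nprod (- int (R + l) - 1) (monom a \<alpha>) (nprod (- int (S - l) - 1) B C)))"
proof -
  note A = monom_Ut[OF a]
  have *: "nprod (- int S - 1) (nprod (- int R - 1) (monom a \<alpha>) (monom b \<beta>)) C =
    (\<Sum>l\<le>S. et_scale (qbinom Q (int (R + l)) l * (Q ^ (\<alpha> + R)) ^ (S - l))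
       (nprod (- int (R + l) - 1) (monom a \<alpha>) (nprod (- int (S - l) - 1) (monom b \<beta>) C)))"
    if b: "b \<in> U \<beta>" for b \<beta>
    using C
  proof (induction rule: Ut_induct)
    case zero
    then show ?case by (simp add: nprod_zero_right A nprod_Ut monom_Ut b)
  next
    case (add C C')
    then show ?case
      by (simp add: nprod_add_right A nprod_Ut monom_Ut b et.scale_right_distrib sum.distrib
          del: of_nat_add of_nat_diff)
  next
    case (monom c \<gamma>)
    show ?case
      unfolding nprod_monom[OF a b] nprod_monom[OF b monom] nprod_monom[OF U_prod_hom[OF a b] monom]
        nprod_monom[OF a U_prod_hom[OF b monom]] prod_hom_assoc[OF a b monom] et_scale_monom monom_sum
      by (intro sum.cong refl arg_cong2[where f = monom]) auto
  qed
  show ?thesis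
    using B
  proof (induction rule: Ut_induct)
    case zero
    then show ?case by (simp add: nprod_zero_right nprod_zero_left A C)
  next
    case (add B B')
    then show ?case
      by (simp add: nprod_add_right nprod_add_left A nprod_Ut C et.scale_right_distrib sum.distrib
          del: of_nat_add of_nat_diff)
  next
    case (monom b \<beta>)
    then show ?case by (rule *)
  qed
qed

lemma qbinom_zero: "0 \<le> m \<Longrightarrow> m < int l \<Longrightarrow> qbinom Q m l = 0"
proof -
  assume "0 \<le> m" "m < int l"
  then have "(\<Prod>i<l. qnum Q (m - int i)) = 0"
    by (intro prod_zero bexI[of _ "nat m"]) (auto simp: qnum_def)
  then show ?thesis by (simp add: qbinom_def)
qed

lemma nprod_associativity:
  assumes A: "A \<in> weight_space V u" "A \<in> Ut" and B: "B \<in> Ut" and C: "C \<in> Ut"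
  shows "nprod k (nprod r A B) C = (\<Sum>l | nprod (k + int l) B C \<noteq> 0.
     et_scale (qbinom Q (int l - r - 1) l * Q powi ((k + int l + 1) * (r - u + 1)))
       (nprod (r - int l) A (nprod (k + int l) B C)))"
proof (cases r rule: negative_int_cases)
  case 1
  \<comment> \<open>For r \<ge> 0 the summands with l \<le> r contain a nonnegative mode, and for l
    > r the upper index l - r - 1 lies between 0 and l - 1, where the binomial vanishes.\<close>
  have "et_scale (qbinom Q (int l - r - 1) l * Q powi ((k + int l + 1) * (r - u + 1)))
       (nprod (r - int l) A (nprod (k + int l) B C)) = 0" for l
    using 1 by (cases "int l \<le> r") (simp_all add: nprod_nonneg qbinom_zero)
  then show ?thesis
    unfolding nprod_nonneg[OF 1] nprod_zero_left[OF C] by (intro sum.neutral[symmetric]) blast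
next
  case r: (2 R)
  show ?thesis
  proof (cases k rule: negative_int_cases)
    case 1
    then show ?thesis by (simp add: nprod_nonneg)
  next
    case k: (2 S)
    let ?f = "\<lambda>l. et_scale (qbinom Q (int l - r - 1) l * Q powi ((k + int l + 1) * (r - u + 1)))
       (nprod (r - int l) A (nprod (k + int l) B C))"
    \<comment> \<open>For l > S the mode k + l is nonnegative. The indices l \<le> S added on the
      right contribute 0, as the inner product is 0 there.\<close>
    have sum: "(\<Sum>l | nprod (k + int l) B C \<noteq> 0. ?f l) = (\<Sum>l\<le>S. ?f l)"
    proof (rule sum.mono_neutral_left)
      show "{l. nprod (k + int l) B C \<noteq> 0} \<subseteq> {..S}"
        using k nprod_nonneg[of "k + int l" for l] by (force simp: not_le)
      show "\<forall>l\<in>{..S} - {l. nprod (k + int l) B C \<noteq> 0}. ?f l = 0"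
        using A by (simp add: nprod_zero_right)
    qed simp
    show ?thesis
    proof (cases "u \<ge> 0")
      case True
      define \<alpha> where "\<alpha> = nat u"
      have u: "u = int \<alpha>" using True by (simp add: \<alpha>_def)
      have "A = monom (coeff A \<alpha>) \<alpha>"
        by (rule poly_eqI) (use A u in \<open>auto simp: weight_space_def\<close>)
      then obtain a where a: "A = monom a \<alpha>" "a \<in> U \<alpha>" using coeff_Ut[OF A(2)] by metis
      show ?thesis
        unfolding sum unfolding r k a(1) nprod_assoc[OF a(2) B C]
      proof (intro sum.cong refl)
        fix l assume "l \<in> {..S}"
        then have l: "l \<le> S" by simp
        have "(Q ^ (\<alpha> + R)) ^ (S - l) = Q ^ ((\<alpha> + R) * (S - l))" by (simp add: power_mult)
        also have "\<dots> = Q powi (int ((\<alpha> + R) * (S - l)))" by (simp only: power_int_of_nat)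
        \<comment> \<open>Both factors of the axiom's exponent are negatives: k + l + 1 = -(S - l)
          and r - u + 1 = -(\<alpha> + R).\<close>
        also have "int ((\<alpha> + R) * (S - l)) = (- int S - 1 + int l + 1) * (- int R - 1 - u + 1)"
          using le_Suc_ex[OF l] by (auto simp: u algebra_simps)
        finally have pw: "(Q ^ (\<alpha> + R)) ^ (S - l) = Q powi ((- int S - 1 + int l + 1) * (- int R - 1 - u + 1))" .
        have e: "- int (S - l) - 1 = - int S - 1 + int l" "- int (R + l) - 1 = - int R - 1 - int l"
          "int (R + l) = int l - (- int R - 1) - 1" using l by auto
        show "et_scale (qbinom Q (int (R + l)) l * (Q ^ (\<alpha> + R)) ^ (S - l))
           (nprod (- int (R + l) - 1) (monom a \<alpha>) (nprod (- int (S - l) - 1) B C)) =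
          et_scale (qbinom Q (int l - (- int R - 1) - 1) l * Q powi ((- int S - 1 + int l + 1) * (- int R - 1 - u + 1)))
           (nprod (- int R - 1 - int l) (monom a \<alpha>) (nprod (- int S - 1 + int l) B C))"
          unfolding pw e(1,2) unfolding e(3) ..
      qed
    next
      case False
      then have "A = 0"
        by (intro poly_eqI) (use A in \<open>auto simp: weight_space_def\<close>)
      then show ?thesis unfolding sum using B C by (simp add: nprod_zero_left nprod_Ut)
    qed
  qed
qed

end

section \<open>The generated \<open>Q\<close>-vertex algebra\<close>

context exchangeable_series
begin

lemma vac_eq: "vac = monom one_ser 0"
  by (simp add: vac_def one_ser_def)

lemma vac_Ut: "vac \<in> Ut"
  unfolding vac_eq by (intro monom_Ut word_U word_one)

lemma qderiv_pow_one_ser: "r > 0 \<Longrightarrow> (qderiv ^^ r) one_ser = 0"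
  using qderiv_pow_zero funpow_Suc_right[of "r - 1" qderiv] by (simp add: o_def)

lemma prod_hom_one_left: "b \<in> E \<Longrightarrow> prod_hom r one_ser 0 b = (if r = 0 then b else 0)"
  by (simp add: prod_hom_eq qderiv_pow_one_ser regular_zero lim_prod_one_left)

lemma nprod_vac_left: "B \<in> Ut \<Longrightarrow> nprod k vac B = (if k = - 1 then B else 0)"
proof (induction rule: Ut_induct)
  case (add A B)
  then show ?case by (simp add: nprod_add_right vac_Ut)
next
  case (monom b \<beta>)
  show ?case
  proof (cases k rule: negative_int_cases)
    case (2 R)
    show ?thesis
      unfolding 2 vac_eq nprod_monom[OF word_U[OF word_one] monom] prod_hom_one_left[OF U_E[OF monom]]
      by simp
  qed (simp add: nprod_nonneg)
qed (simp add: nprod_zero_right vac_Ut)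

lemma nprod_vac_right: "A \<in> Ut \<Longrightarrow> nprod (- 1) A vac = A"
proof (induction rule: Ut_induct)
  case (add A B)
  then show ?case by (simp add: nprod_add_left vac_Ut)
next
  case (monom a \<alpha>)
  then show ?case
    using nprod_monom[OF monom word_U[OF word_one], of 0]
    by (simp add: vac_eq prod_hom_eq lim_prod_one_right U_E)
qed (simp add: nprod_zero_left vac_Ut)

lemma quasi_comm_Ut: "A \<in> Ut \<Longrightarrow> B \<in> Ut \<Longrightarrow> quasi_comm A B"
  unfolding quasi_comm_def quasi_comm_hom_eq by (auto intro: U_lim_prod(1)[OF coeff_Ut coeff_Ut])

lemma nprod_coeff_weight:
  assumes "A \<in> weight_space V u" "B \<in> weight_space V t" "coeff (nprod r A B) \<delta> \<noteq> 0" "A \<in> Ut"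
  shows "int \<delta> = t + u - r - 1"
proof (cases r rule: negative_int_cases)
  case 1
  then show ?thesis using assms by (simp add: nprod_nonneg)
next
  case (2 R)
  have "\<exists>\<alpha> \<beta>. coeff (monom (prod_hom R (coeff A \<alpha>) \<alpha> (coeff B \<beta>)) (\<alpha> + \<beta> + R)) \<delta> \<noteq> 0"
    using assms(3) unfolding 2 nprod_neg coeff_sum
    by (meson sum.not_neutral_contains_not_neutral)
  then obtain \<alpha> \<beta> where nz: "prod_hom R (coeff A \<alpha>) \<alpha> (coeff B \<beta>) \<noteq> 0" and \<delta>: "\<delta> = \<alpha> + \<beta> + R"
    by (auto split: if_splits)
  have "coeff A \<alpha> \<noteq> 0" "coeff B \<beta> \<noteq> 0"
    using nz prod_hom_zero_left prod_hom_zero_right[OF U_E[OF coeff_Ut[OF assms(4)]]] by metis+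
  then have "int \<alpha> = u" "int \<beta> = t" using assms by (auto simp: weight_space_def)
  then show ?thesis using 2 \<delta> by simp
qed

lemma weight_decomposition:
  assumes "et.subspace V" "\<And>\<alpha>. monom (coeff A \<alpha>) \<alpha> \<in> V"
  shows "\<exists>!f. (\<forall>u. f u \<in> weight_space V u) \<and> finite {u. f u \<noteq> 0} \<and> A = (\<Sum>u | f u \<noteq> 0. f u)"
proof -
  have uniq: "coeff (g u) \<alpha> = (if int \<alpha> = u then coeff A \<alpha> else 0)"
    if g: "\<forall>u. g u \<in> weight_space V u" "finite {u. g u \<noteq> 0}" "A = (\<Sum>u | g u \<noteq> 0. g u)" for g u \<alpha>
  proof -
    have z: "coeff (g u) \<alpha> = 0" if "int \<alpha> \<noteq> u" for u \<alpha>
      using g(1) that by (auto simp: weight_space_def)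
    have "coeff A \<alpha> = (\<Sum>u | g u \<noteq> 0. coeff (g u) \<alpha>)"
      by (subst g(3)) (rule coeff_sum)
    also have "\<dots> = (\<Sum>u | g u \<noteq> 0. if u = int \<alpha> then coeff (g u) \<alpha> else 0)"
      using z by (intro sum.cong) auto
    also have "\<dots> = coeff (g (int \<alpha>)) \<alpha>"
      using g(2) by (simp add: sum.delta')
    finally show ?thesis using z by auto
  qed
  \<comment> \<open>Weights are integers while exponents of t are natural numbers, so negative
    weights receive 0.\<close>
  let ?f = "\<lambda>u. if u \<ge> 0 then monom (coeff A (nat u)) (nat u) else 0"
  have sub: "{u. ?f u \<noteq> 0} \<subseteq> int ` {..degree A}"
  proof
    fix u assume "u \<in> {u. ?f u \<noteq> 0}"
    then have u: "u \<ge> 0" "coeff A (nat u) \<noteq> 0" by (auto split: if_splits)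
    then show "u \<in> int ` {..degree A}"
      by (intro image_eqI[of _ _ "nat u"]) (auto intro: le_degree)
  qed
  have "(\<Sum>u | ?f u \<noteq> 0. ?f u) = sum ?f (int ` {..degree A})"
    by (rule sum.mono_neutral_left) (use sub in auto)
  also have "\<dots> = (\<Sum>i\<le>degree A. monom (coeff A i) i)"
    by (subst sum.reindex) simp_all
  finally have "A = (\<Sum>u | ?f u \<noteq> 0. ?f u)" by (simp add: poly_as_sum_of_monoms)
  moreover have "finite {u. ?f u \<noteq> 0}" by (rule finite_subset[OF sub]) simp
  moreover have "\<forall>u. ?f u \<in> weight_space V u"
    using assms et.subspace_0[OF assms(1)] by (auto simp: weight_space_def)
  ultimately show ?thesis
  proof (intro ex1I[of _ ?f])
    fix g assume g: "(\<forall>u. g u \<in> weight_space V u) \<and> finite {u. g u \<noteq> 0} \<and> A = (\<Sum>u | g u \<noteq> 0. g u)"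
    show "g = ?f"
    proof
      fix u
      have "coeff (g u) \<alpha> = (if int \<alpha> = u then coeff A \<alpha> else 0)" for \<alpha> using uniq g by blast
      then show "g u = ?f u" by (intro poly_eqI) auto
    qed
  qed blast
qed

text \<open>All axioms that are identities hold throughout \<open>Ut\<close>. What has to be checked
  for a particular subspace is closure, including closure under homogeneous components for the
  direct sum.\<close>

theorem qva_in_EtI:
  assumes sub: "et.subspace V" and V: "V \<subseteq> Ut" and one: "vac \<in> V"
    and closed: "\<And>r A B. A \<in> V \<Longrightarrow> B \<in> V \<Longrightarrow> nprod r A B \<in> V"
    and hom: "\<And>A \<alpha>. A \<in> V \<Longrightarrow> monom (coeff A \<alpha>) \<alpha> \<in> V"
  shows "qva_in_Et V"
proof -
  have Ut: "A \<in> Ut" if "A \<in> V" for A using V that by blast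
  have wV: "A \<in> V" if "A \<in> weight_space V u" for A u using that by (simp add: weight_space_def)
  have "graded_nonlocal_qva et_scale Q V (weight_space V) nprod vac"
  proof unfold_locales
    show "et.subspace (weight_space V u)" for u
    proof (rule et.subspaceI)
      fix A B assume "A \<in> weight_space V u" "B \<in> weight_space V u"
      then show "A + B \<in> weight_space V u"
        using et.subspace_add[OF sub] by (auto simp: weight_space_def) (metis add_0)
    next
      fix c A assume "A \<in> weight_space V u"
      then show "et_scale c A \<in> weight_space V u"
        using et.subspace_scale[OF sub]
        by (auto simp: weight_space_def coeff_et_scale')
    qed (use et.subspace_0[OF sub] in \<open>simp add: weight_space_def\<close>)
    show "A \<in> V \<Longrightarrow> \<exists>!f. (\<forall>u. f u \<in> weight_space V u) \<and> finite {u. f u \<noteq> 0} \<and> A = (\<Sum>u | f u \<noteq> 0. f u)" for A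
      using weight_decomposition[OF sub] hom by blast
    show "\<exists>N. \<forall>r\<ge>N. nprod r A B = 0" if "A \<in> V" "B \<in> V" for A B
      by (intro exI[of _ 0] allI impI nprod_nonneg)
    show "nprod r A B \<in> weight_space V (t + u - r - 1)"
      if "A \<in> weight_space V u" "B \<in> weight_space V t" for A B u t r
      using nprod_coeff_weight[OF that _ Ut[OF wV[OF that(1)]]] closed[OF wV[OF that(1)] wV[OF that(2)]]
      unfolding weight_space_def by blast
    show "nprod t (nprod r A B) C = (\<Sum>l | nprod (t + int l) B C \<noteq> 0.
        et_scale (qbinom Q (int l - r - 1) l * Q powi ((t + int l + 1) * (r - u + 1)))
         (nprod (r - int l) A (nprod (t + int l) B C)))"
      if "A \<in> weight_space V u" "B \<in> V" "C \<in> V" for A B C u t r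
      using nprod_associativity[OF that(1) Ut[OF wV[OF that(1)]] Ut[OF that(2)] Ut[OF that(3)]] .
  qed (use sub one closed Ut in \<open>auto simp: weight_space_def nprod_add_left nprod_add_right
        nprod_scale_left nprod_scale_right nprod_vac_left nprod_vac_right nprod_nonneg\<close>)
  then show ?thesis
    using V Ut_Et quasi_comm_Ut Ut unfolding qva_in_Et_def by blast
qed

section \<open>Monomials in the generators and their span\<close>

definition gen_word :: "('i \<times> int) list \<Rightarrow> 'l ser poly" where
  "gen_word ws = foldr (\<lambda>(i, r). nprod r (monom (gen i) 0)) ws vac"

definition gen_words :: "'l ser poly set" where
  "gen_words = {gen_word ws | ws. \<forall>(i, r) \<in> set ws. i \<in> I \<and> r < 0}"

lemma gen_word_simps [simp]:
  "gen_word [] = vac" "gen_word ((i, r) # ws) = nprod r (monom (gen i) 0) (gen_word ws)"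
  by (simp_all add: gen_word_def)

lemma gen_Ut: "i \<in> I \<Longrightarrow> monom (gen i) 0 \<in> Ut"
  by (intro monom_Ut word_U word_gen)

text \<open>Homogeneity of the monomials makes their span closed under homogeneous
  components.\<close>

lemma gen_word_monom:
  "\<forall>(i, r) \<in> set ws. i \<in> I \<and> r < 0 \<Longrightarrow> \<exists>w \<alpha>. w \<in> U \<alpha> \<and> gen_word ws = monom w \<alpha>"
proof (induction ws)
  case Nil
  then show ?case using word_U[OF word_one] vac_eq by auto
next
  case (Cons ar ws)
  obtain i r where ar: "ar = (i, r)" by force
  obtain w \<alpha> where w: "w \<in> U \<alpha>" "gen_word ws = monom w \<alpha>" using Cons by auto
  have a: "gen i \<in> U 0" using Cons.prems ar by (auto intro: word_U word_gen)
  obtain R where "r = - int R - 1"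
    using Cons.prems ar by (cases r rule: negative_int_cases) auto
  then show ?case
    using nprod_monom[OF a w(1), of R] U_prod_hom[OF a w(1), of R] ar w(2) by auto
qed

abbreviation W :: "'l ser poly set" where
  "W \<equiv> et.span gen_words"

lemma W_Ut: "W \<subseteq> Ut"
  by (rule et.span_minimal[OF _ subspace_Ut]) (auto simp: gen_words_def dest!: gen_word_monom intro: monom_Ut)

lemma monom_coeff_W: "A \<in> W \<Longrightarrow> monom (coeff A \<alpha>) \<alpha> \<in> W"
proof (induction rule: et.span_induct_alt)
  case base
  then show ?case by (simp add: et.span_zero)
next
  case (step c A B)
  obtain ws where ws: "A = gen_word ws" "\<forall>(i, r) \<in> set ws. i \<in> I \<and> r < 0"
    using step(1) unfolding gen_words_def by blast
  obtain w \<beta> where w: "A = monom w \<beta>" using gen_word_monom[OF ws(2)] ws(1) by auto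
  have "monom (coeff A \<alpha>) \<alpha> \<in> W"
    using et.span_base[OF step(1)] w by (cases "\<alpha> = \<beta>") (auto simp: et.span_zero)
  moreover have "monom (coeff (et_scale c A + B) \<alpha>) \<alpha> =
      et_scale c (monom (coeff A \<alpha>) \<alpha>) + monom (coeff B \<alpha>) \<alpha>"
    by (simp add: coeff_et_scale' et_scale_monom add_monom)
  ultimately show ?case
    using step(2) by (simp only:) (intro et.span_add et.span_scale)
qed

lemma nprod_gen_W:
  assumes a: "i \<in> I" and "B \<in> W"
  shows "nprod r (monom (gen i) 0) B \<in> W"
proof -
  \<comment> \<open>Membership in \<open>Ut\<close> is part of the set because \<open>nprod\<close>
    is known to be linear only there.\<close>
  have "W \<subseteq> {B \<in> Ut. nprod r (monom (gen i) 0) B \<in> W}"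
  proof (rule et.span_minimal)
    show "gen_words \<subseteq> {B \<in> Ut. nprod r (monom (gen i) 0) B \<in> W}"
    proof
      fix A assume A: "A \<in> gen_words"
      then obtain ws where ws: "A = gen_word ws" "\<forall>(i, r) \<in> set ws. i \<in> I \<and> r < 0"
        by (auto simp: gen_words_def)
      have "nprod r (monom (gen i) 0) A \<in> W"
      proof (cases "r < 0")
        case True
        then have "nprod r (monom (gen i) 0) A \<in> gen_words"
          unfolding gen_words_def using ws a by (auto intro!: exI[of _ "(i, r) # ws"])
        then show ?thesis by (rule et.span_base)
      qed (simp add: nprod_nonneg et.span_zero)
      then show "A \<in> {B \<in> Ut. nprod r (monom (gen i) 0) B \<in> W}"
        using A W_Ut et.span_base by blast
    qed
    show "et.subspace {B \<in> Ut. nprod r (monom (gen i) 0) B \<in> W}"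
      by (rule et.subspaceI) (auto simp: nprod_zero_right nprod_add_right nprod_scale_right gen_Ut a
          Ut_closed et.span_zero et.span_add et.span_scale)
  qed
  then show ?thesis using assms by blast
qed

text \<open>Associativity with the leading generator (of weight 0) as first factor rewrites (g_r
  w)_k B as a combination of g_(r-l) (w_(k+l) B), where w is a shorter monomial.\<close>

lemma nprod_gen_word_W:
  assumes "\<forall>(i, r) \<in> set ws. i \<in> I \<and> r < 0" "B \<in> W"
  shows "nprod k (gen_word ws) B \<in> W"
  using assms
\<comment> \<open>The mode varies because the shorter monomial is applied with the modes k +
  l.\<close>
proof (induction ws arbitrary: k)
  case Nil
  then show ?case using W_Ut by (auto simp: nprod_vac_left et.span_zero)
next
  case (Cons ar ws)
  obtain i r where ar: "ar = (i, r)" by force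
  have a: "i \<in> I" and ws: "\<forall>(i, r) \<in> set ws. i \<in> I \<and> r < 0" using Cons.prems ar by auto
  have w: "gen_word ws \<in> Ut" using gen_word_monom[OF ws] by (auto intro: monom_Ut)
  have g: "monom (gen i) 0 \<in> weight_space Ut 0" using gen_Ut[OF a] by (auto simp: weight_space_def)
  have B: "B \<in> Ut" using Cons.prems(2) W_Ut by blast
  show ?case
    unfolding ar gen_word_simps nprod_associativity[OF g gen_Ut[OF a] w B]
    by (intro et.span_sum et.span_scale nprod_gen_W[OF a] Cons.IH[OF ws Cons.prems(2)])
qed

lemma nprod_W:
  assumes "A \<in> W" and B: "B \<in> W"
  shows "nprod k A B \<in> W"
proof -
  have "W \<subseteq> {A \<in> Ut. nprod k A B \<in> W}"
  proof (rule et.span_minimal)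
    show "gen_words \<subseteq> {A \<in> Ut. nprod k A B \<in> W}"
    proof
      fix A assume A: "A \<in> gen_words"
      then obtain ws where "A = gen_word ws" "\<forall>(i, r) \<in> set ws. i \<in> I \<and> r < 0"
        unfolding gen_words_def by blast
      then show "A \<in> {A \<in> Ut. nprod k A B \<in> W}"
        using nprod_gen_word_W[OF _ B] W_Ut et.span_base[OF A] by auto
    qed
    show "et.subspace {A \<in> Ut. nprod k A B \<in> W}"
      using W_Ut B
      by (intro et.subspaceI) (auto simp: nprod_zero_left nprod_add_left nprod_scale_left
          Ut_closed et.span_zero et.span_add et.span_scale subset_iff)
  qed
  then show ?thesis using assms by blast
qed

lemma vac_W: "vac \<in> W"
  by (rule et.span_base) (auto simp: gen_words_def intro!: exI[of _ "[]"])

theorem smallest_qva_W: "smallest_qva {monom (gen i) 0 | i. i \<in> I} W"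
proof -
  have "monom (gen i) 0 \<in> W" if "i \<in> I" for i
    using nprod_gen_W[OF that vac_W, of "- 1"] nprod_vac_right[OF gen_Ut[OF that]] by simp
  moreover have "qva_in_Et W"
    by (rule qva_in_EtI) (use W_Ut vac_W nprod_W monom_coeff_W in auto)
  \<comment> \<open>Any competitor contains the vacuum and the generators and is a subspace closed
    under the modes, hence contains every monomial and the span.\<close>
  moreover have "W \<subseteq> V" if V: "qva_in_Et V" "{monom (gen i) 0 | i. i \<in> I} \<subseteq> V" for V
  proof -
    interpret graded_nonlocal_qva et_scale Q V "weight_space V" nprod vac
      using V(1) by (simp add: qva_in_Et_def)
    have "gen_word ws \<in> V" if "\<forall>(i, r) \<in> set ws. i \<in> I \<and> r < 0" for ws
      using that
    proof (induction ws)
      case (Cons ar ws)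
      then show ?case using V(2) by (cases ar) (auto intro!: md_closed)
    qed (simp add: vac_in)
    then show ?thesis
      by (intro et.span_minimal subspace_V) (auto simp: gen_words_def)
  qed
  ultimately show ?thesis unfolding smallest_qva_def by blast
qed

end

section \<open>Currents of the quantum affine algebra\<close>

lemma q_half_pow: "q_half ^ n = Fract (monom 1 n) 1"
proof (induction n)
  case (Suc n)
  have "[:0, 1:] = monom (1 :: complex) 1" by (simp add: monom_altdef)
  then show ?case unfolding power_Suc Suc.IH by (simp add: q_half_def mult_monom)
qed (simp add: One_fract_def)

lemma q_half_pow_neq_1: assumes "n > 0" shows "q_half ^ n \<noteq> 1"
proof
  assume "q_half ^ n = 1"
  then have "monom (1 :: complex) n = 1"
    unfolding q_half_pow One_fract_def by (subst (asm) eq_fract) simp_all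
  then have "degree (monom (1 :: complex) n) = 0" by simp
  then show False using assms by (simp add: degree_monom_eq)
qed

lemma qq_nz [simp]: "qq \<noteq> 0"
proof -
  have "q_half \<noteq> 0" by (simp add: q_half_def Zero_fract_def eq_fract)
  then show ?thesis by (simp add: qq_def)
qed

lemma qq_powi_neq_1: assumes "k \<noteq> 0" shows "qq powi k \<noteq> 1"
proof -
  have pos: "qq ^ m \<noteq> 1" if "m > 0" for m
    using q_half_pow_neq_1[of "2 * m"] that by (simp add: qq_def power_mult)
  show ?thesis
  proof (cases "k > 0")
    case True
    then have "qq powi k = qq ^ nat k" by (simp add: power_int_def)
    then show ?thesis using pos[of "nat k"] True by simp
  next
    case False
    then have "qq powi k = inverse (qq ^ nat (- k))" using assms by (simp add: power_int_def power_inverse)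
    then show ?thesis using pos[of "nat (- k)"] False assms by (simp add: inverse_eq_1_iff)
  qed
qed

lemma qq_powi_power: "(qq powi k) ^ m = qq powi (k * int m)"
  unfolding power_int_mult power_int_of_nat ..

section \<open>Cartan entries away from the affine node\<close>

lemma length_filter_le_1:
  assumes "distinct xs" "\<And>x y. x \<in> set xs \<Longrightarrow> y \<in> set xs \<Longrightarrow> P x \<Longrightarrow> P y \<Longrightarrow> x = y"
  shows "length (filter P xs) \<le> 1"
proof -
  have "length (filter P xs) = card (set (filter P xs))"
    by (rule distinct_card[OF distinct_filter[OF assms(1)], symmetric])
  also have "\<dots> \<le> 1"
    using assms(2) by (intro card_le_Suc0_iff_eq[THEN iffD2, simplified One_nat_def[symmetric]]) auto
  finally show ?thesis .
qed

lemma affine_cartan_finite_part: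
  assumes "ade_valid Y" "i \<ge> 1" "j \<ge> 1" "i \<noteq> j"
  shows "affine_cartan Y i j \<in> {0, - 1}"
proof -
  have dist: "distinct (affine_edges Y)"
    using assms(1) by (cases Y) (auto simp: distinct_map inj_on_def)
  have "length (filter (\<lambda>e. e = (i, j) \<or> e = (j, i)) (affine_edges Y)) \<le> 1"
  proof (rule length_filter_le_1[OF dist])
    fix e f assume "e \<in> set (affine_edges Y)" "f \<in> set (affine_edges Y)"
      "e = (i, j) \<or> e = (j, i)" "f = (i, j) \<or> f = (j, i)"
    \<comment> \<open>The only pair of edges with the same two ends is the double edge of
      \<open>TypeA 1\<close>. It meets node 0, which is excluded by i, j \<ge> 1.\<close>
    then show "e = f" using assms by (cases Y) auto
  qed
  then have "length (filter (\<lambda>e. e = (i, j) \<or> e = (j, i)) (affine_edges Y)) \<in> {0, 1}"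
    by (simp only: insert_iff empty_iff) linarith
  then show ?thesis using assms(4) by (auto simp: affine_cartan_def simp del: length_0_conv)
qed

lemma affine_ADE_entries:
  assumes "affine_ADE n C" "i \<in> {1..n}" "j \<in> {1..n}"
  shows "i = j \<and> C i j = 2 \<or> i \<noteq> j \<and> C i j \<in> {0, - 1}"
proof -
  obtain Y \<pi> where Y: "ade_valid Y" and \<pi>: "bij_betw \<pi> {0..n} {0..n}" "\<pi> 0 = 0"
    and C: "\<forall>i\<le>n. \<forall>j\<le>n. C i j = affine_cartan Y (\<pi> i) (\<pi> j)"
    using assms(1) by (auto simp: affine_ADE_def)
  have inj: "inj_on \<pi> {0..n}" using \<pi>(1) by (rule bij_betw_imp_inj_on)
  have "\<pi> i \<noteq> 0" "\<pi> j \<noteq> 0" "i \<noteq> j \<Longrightarrow> \<pi> i \<noteq> \<pi> j"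
    using inj_onD[OF inj, of i 0] inj_onD[OF inj, of j 0] inj_onD[OF inj, of i j] assms(2,3) \<pi>(2) by auto
  then show ?thesis
    using affine_cartan_finite_part[OF Y, of "\<pi> i" "\<pi> j"] C assms(2,3)
    by (auto simp: affine_cartan_def)
qed


section \<open>Exchange relations of the currents\<close>

context Uq_affine_module
begin

text \<open>The module carries no \<open>Q\<close>, so constants depending on it take
  \<open>Q\<close> as an explicit argument in this locale, as in \<open>exch Q\<close>.\<close>

sublocale operator_series s Q for Q by unfold_locales

lemma current_E:
  assumes "restricted n \<rho>" "i \<in> {1..n}"
  shows "current \<rho> (- 1) i \<in> E"
proof -
  have "\<exists>N. \<forall>m<N. \<rho> (X (- 1) i (- m - 1)) v = 0" for v
  proof -
    obtain N where "\<forall>r\<ge>N. \<rho> (X (- 1) i r) v = 0"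
      using assms unfolding restricted_def by (meson insertCI)
    then have "\<forall>m<(- N). \<rho> (X (- 1) i (- m - 1)) v = 0" by simp
    then show ?thesis by blast
  qed
  moreover have "Vector_Spaces.linear s s (\<rho> (X (- 1) i k))" for k
    by (rule linear_gen) (use assms(2) in \<open>auto simp: generators_def\<close>)
  ultimately show ?thesis by (simp add: E_def current_def)
qed

text \<open>For \<open>C i j = 0\<close> the exchange relation has \<open>p = 1 - z\<close>, which vanishes at 1; here the Serre
  relation, which for \<open>m = 1\<close> is a commutator, is needed.\<close>

lemma current_commute:
  assumes "i \<in> {1..n}" "j \<in> {1..n}" "i \<noteq> j" "C i j = 0"
  shows "\<rho> (X (- 1) i l) (\<rho> (X (- 1) j k) v) = \<rho> (X (- 1) j k) (\<rho> (X (- 1) i l) v)"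
proof -
  \<comment> \<open>This is the denominator of \<open>sqnum\<close>. Its being nonzero gives
    \<open>sqnum 1 = 1\<close> and makes both binomials of the Serre relation equal to 1.\<close>
  have "qq - qq powi (- 1) \<noteq> 0"
  proof
    assume "qq - qq powi (- 1) = 0"
    then have "qq powi 1 * qq powi 1 = qq powi (- 1) * qq powi 1" by simp
    then have "qq powi 2 = 1" by (simp only: power_int_add[symmetric] qq_nz simp_thms) simp
    then show False using qq_powi_neq_1[of 2] by simp
  qed
  then have binom: "sqbinom (Suc 0) 0 = 1" "sqbinom (Suc 0) (Suc 0) = 1"
    by (simp_all add: sqbinom_def sqnum_def)
  have perms: "{\<sigma>. \<sigma> permutes {..<Suc 0}} = {id}" by (auto simp: lessThan_Suc)
  have "s (sqbinom 1 0) (\<rho> (X (- 1) j k) (\<rho> (X (- 1) i l) v)) -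
      s (sqbinom 1 1) (\<rho> (X (- 1) i l) (\<rho> (X (- 1) j k) v)) = 0"
    using Serre[OF assms(1,2,3), of "- 1" 1 "\<lambda>_. l" k v] assms(4) by (simp add: perms)
  then show ?thesis by (simp add: binom)
qed

lemma current_exch:
  assumes "affine_ADE n C" "Q = qq powi (- 2)" "i \<in> {1..n}" "j \<in> {1..n}"
  shows "exch Q (current \<rho> (- 1) i) (current \<rho> (- 1) j)"
proof (cases "C i j = 0")
  case True
  then have "i \<noteq> j" using affine_ADE_entries[OF assms(1,3,4)] by auto
  then have "exch_by 1 1 (current \<rho> (- 1) i) (current \<rho> (- 1) j)"
    using current_commute[OF assms(3,4) _ True] by (simp add: exch_by_def current_def)
  then show ?thesis unfolding exch_def using poly0_1 by blast
next
  case False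
  let ?c = "qq powi (- C i j)"
  let ?x = "current \<rho> (- 1)"
  have C: "C i j \<in> {2, - 1}" using affine_ADE_entries[OF assms(1,3,4)] False by auto
  \<comment> \<open>The polynomial 1 - c z must not vanish at Q^m. The exponent of q is -2 - 2m for
    entry 2, which is negative, and 1 - 2m for entry -1, which is odd.\<close>
  have c: "?c * Q ^ m \<noteq> 1" for m
  proof -
    have "?c * Q ^ m = qq powi (- C i j - 2 * int m)"
      using power_int_add[of qq "- C i j" "- 2 * int m"] by (simp add: assms(2) qq_powi_power)
    moreover have "- C i j - 2 * int m \<noteq> 0" using C by auto presburger
    ultimately show ?thesis using qq_powi_neq_1 by simp
  qed
  have c1: "1 - ?c \<noteq> 0" using c[of 0] by simp
  let ?p = "smult (1 / (1 - ?c)) [:1, - ?c:]" and ?g = "smult (1 / (1 - ?c)) [:?c, - 1:]"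
  have "?p \<in> poly0 Q"
    using c c1 by (auto simp: poly0_def mult.commute diff_divide_distrib[symmetric])
  moreover have "exch_by ?p ?g (?x i) (?x j)"
    unfolding exch_by_def
  proof (intro allI)
    fix m k :: int and v
    have e: "- m - 2 + 1 = - m - 1" "- k - 1 + 1 = - k" "- (m + 1) - 1 = - m - 2" "- (k - 1) - 1 = - k"
      "- 1 * C i j = - C i j" by simp_all
    \<comment> \<open>Coefficient m of a current is the mode - m - 1, so raising a mode by one
      lowers the coefficient index. The relation \<open>X_X\<close> is therefore taken at the modes
      - m - 2 and - k - 1.\<close>
    have "?x i m (?x j k v) - s ?c (?x j k (?x i m v)) =
        s ?c (?x i (m + 1) (?x j (k - 1) v)) - ?x j (k - 1) (?x i (m + 1) v)"
      using X_X[OF assms(3,4), of "- 1" "- m - 2" "- k - 1" v]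
      unfolding current_def e by simp
    then show "pair ?p (\<lambda>r. ?x i (m + int r) (?x j (k - int r) v)) =
        pair ?g (\<lambda>r. ?x j (k - int r) (?x i (m + int r) v))"
      unfolding pair_smult by (intro arg_cong[where f = "s (1 / (1 - ?c))"]) (simp add: pair_pCons algebra_simps)
  qed
  ultimately show ?thesis unfolding exch_def by blast
qed

end

theorem corollary2p17:
  fixes s :: "qfield \<Rightarrow> 'l::ab_group_add \<Rightarrow> 'l"
    and n :: nat
    and C :: "nat \<Rightarrow> nat \<Rightarrow> int"
    and \<rho> :: "drinfeld_gen \<Rightarrow> 'l \<Rightarrow> 'l"
    and Q :: qfield
    and T :: "'l ser poly set"
  assumes "affine_ADE n C"
    and "Uq_affine_module s n C \<rho>"
    and "restricted n \<rho>"
    and "Q = qq powi (- 2)"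
    and "T = {monom (current \<rho> (- 1) i) 0 | i. i \<in> {1..n}}"
  shows "T \<subseteq> operator_series.Et s \<and>
    (\<exists>!V. operator_series.smallest_qva s Q T V) \<and>
    operator_series.generated_qva s Q T =
      module.span (operator_series.et_scale s)
        {foldr (\<lambda>(i, r). operator_series.nprod s Q r (monom (current \<rho> (- 1) i) 0)) ws
           (operator_series.vac :: 'l ser poly) | ws :: (nat \<times> int) list.
         \<forall>(i, r) \<in> set ws. i \<in> {1..n} \<and> r < 0}"
proof -
  interpret M: Uq_affine_module s n C \<rho> by fact
  have Q: "Q \<noteq> 0" "Q ^ m \<noteq> 1" if "m > 0" for m
    using qq_powi_neq_1[of "- 2 * int m"] that
    by (simp_all add: assms(4) qq_powi_power)
  interpret exchangeable_series s Q "{1..n}" "current \<rho> (- 1)"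
    by unfold_locales
       (use Q assms M.current_E M.current_exch in auto)
  have W: "M.smallest_qva Q T W" using smallest_qva_W assms(5) by simp
  have unique: "V = W" if "M.smallest_qva Q T V" for V
    using W that unfolding M.smallest_qva_def by blast
  have "M.generated_qva Q T = W"
    unfolding M.generated_qva_def by (rule the_equality[where P = "M.smallest_qva Q T", OF W unique])
  moreover have "T \<subseteq> M.Et" using W unfolding M.smallest_qva_def M.qva_in_Et_def by blast
  moreover have "\<exists>!V. M.smallest_qva Q T V" by (rule ex1I[where P = "M.smallest_qva Q T", OF W unique])
  ultimately show ?thesis unfolding gen_words_def gen_word_def by (intro conjI)
qed

end
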